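(* Let $n\ge2$ and let $(x_k)_{k\in\mathbb{Z}}$ be the stationary iterates of SGDM with stepsize $\gamma>0$ and momentum $\alpha\in[0,1)$ under the zero-th order noise model with the random reshuffling (RR) sampling scheme with randomized first iteration of the reshuffle (defined in the context), and assume $(1+\alpha)\mathrm{Id}-\gamma A\succeq0$. Then for every $k$ $$\mathrm{Tr}[\mathrm{Var}(x_k)]=\gamma^2\sum_{i=1}^d(u_i^\top\Sigma u_i)\int_0^1\left|e^{-4\pi \mathrm{i}f}-e^{-2\pi \mathrm{i}f}(1+\alpha-\gamma\lambda_i)+\alpha\right|^{-2}r_n(2\pi f)\,df,$$ where $\mathrm{i}$ in the exponents is the imaginary unit and $$r_n(x)=\frac{n}{n-1}-\frac{1}{n(n-1)}\left(\frac{\sin((n-\frac12)x)}{\sin(\frac x2)}+\frac{\sin^2(\frac{(n-1)x}{2})}{\sin^2(\frac x2)}\right).$$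
   Context: Let $A_1,\dots,A_n\in\mathbb{R}^{d\times d}$ be symmetric and $b_1,\dots,b_n\in\mathbb{R}^d$; put $A=\frac1n\sum_i A_i$, assumed symmetric positive definite, $b=\frac1n\sum_i b_i$, $x^\star=-A^{-1}b$, $y_i=-A_iA^{-1}b+b_i$ (so $\sum_i y_i=0$), $\Sigma=\frac1n\sum_{i=1}^n y_iy_i^\top$. Let $(u_i)_{i=1}^d$ be an orthonormal basis of eigenvectors of $A$, $Au_i=\lambda_iu_i$, $\lambda_i>0$. Zero-th order noise model: the gradient of $f_i(x)=\frac12x^\top A_ix+b_i^\top x$ is replaced by $\widehat{\nabla f_i}(x)=Ax+y_i+b$. SGDM: $x_{k+1}=x_k+\alpha(x_k-x_{k-1})-\gamma\widehat{\nabla f_{i_k}}(x_k)$; equivalently, with $\Delta x_k=x_k-x^\star$, $\Delta x_{k+1}=((1+\alpha)\mathrm{Id}-\gamma A)\Delta x_k-\alpha\Delta x_{k-1}-\gamma y_{i_k}$. Random reshuffling with randomized start: let $T$ be uniform on $\{0,\dots,n-1\}$; conditionally on $T$, the blocks $(i_{T+nm},\dots,i_{T+nm+n-1})$, $m\in\mathbb{Z}$, are independent uniformly random permutations of $\{1,\dots,n\}$. Stationary iterates: $\Delta x_k=\sum_{j\in\mathbb{Z}}H_{k-j}y_{i_j}$, where $(H_k)_{k\in\mathbb{Z}}$ are the matrices with $\sum_kH_kz^{-k}=H(z):=-\gamma z(z^2\mathrm{Id}-z((1+\alpha)\mathrm{Id}-\gamma A)+\alpha\mathrm{Id})^{-1}$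 for $|z|=1$. The function $r_n$ is extended by continuity at multiples of $2\pi$. *)

theory Defs
  imports "HOL-Probability.Probability" "HOL-Combinatorics.Multiset_Permutations"
begin

section \<open>Matrices\<close>

definition pos_semidef :: "real^'d^'d \<Rightarrow> bool" where
  "pos_semidef M \<longleftrightarrow> transpose M = M \<and> (\<forall>v. v \<bullet> (M *v v) \<ge> 0)"

definition pos_def :: "real^'d^'d \<Rightarrow> bool" where
  "pos_def M \<longleftrightarrow> transpose M = M \<and> (\<forall>v. v \<noteq> 0 \<longrightarrow> v \<bullet> (M *v v) > 0)"

definition outer :: "real^'d \<Rightarrow> real^'d \<Rightarrow> real^'d^'d" where
  "outer v w = (\<chi> i j. v $ i * w $ j)"

definition cmatrix :: "real^'d^'d \<Rightarrow> complex^'d^'d" where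
  "cmatrix M = map_matrix complex_of_real M"

definition cscale :: "complex \<Rightarrow> complex^'d^'d \<Rightarrow> complex^'d^'d" where
  "cscale c M = map_matrix ((*) c) M"

definition covariance_matrix :: "'w measure \<Rightarrow> ('w \<Rightarrow> real^'d) \<Rightarrow> real^'d^'d" where
  "covariance_matrix M X =
     (LINT \<omega>|M. outer (X \<omega> - (LINT \<omega>'|M. X \<omega>')) (X \<omega> - (LINT \<omega>'|M. X \<omega>')))"


section \<open>Quadratic objectives and the zero-th order noise model\<close>

text \<open>The objectives are indexed by \<open>1, \<dots>, n\<close>; the argument \<open>n\<close> is
  the number of objectives, and values of \<open>A\<close> and \<open>b\<close> at other indices
  are never used.\<close>

definition mean :: "nat \<Rightarrow> (nat \<Rightarrow> 'a) \<Rightarrow> 'a::real_vector" where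
  "mean n X = (1 / real n) *\<^sub>R (\<Sum>i=1..n. X i)"

definition minimizer :: "nat \<Rightarrow> (nat \<Rightarrow> real^'d^'d) \<Rightarrow> (nat \<Rightarrow> real^'d) \<Rightarrow> real^'d" where
  "minimizer n A b = - (matrix_inv (mean n A) *v mean n b)"

definition noise :: "nat \<Rightarrow> (nat \<Rightarrow> real^'d^'d) \<Rightarrow> (nat \<Rightarrow> real^'d) \<Rightarrow> nat \<Rightarrow> real^'d" where
  "noise n A b i = - (A i *v (matrix_inv (mean n A) *v mean n b)) + b i"

definition noise_cov :: "nat \<Rightarrow> (nat \<Rightarrow> real^'d^'d) \<Rightarrow> (nat \<Rightarrow> real^'d) \<Rightarrow> real^'d^'d" where
  "noise_cov n A b = mean n (\<lambda>i. outer (noise n A b i) (noise n A b i))"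

definition noisy_grad ::
  "nat \<Rightarrow> (nat \<Rightarrow> real^'d^'d) \<Rightarrow> (nat \<Rightarrow> real^'d) \<Rightarrow> nat \<Rightarrow> real^'d \<Rightarrow> real^'d" where
  "noisy_grad n A b i x = mean n A *v x + noise n A b i + mean n b"


section \<open>Random reshuffling with randomized start\<close>

definition block :: "nat \<Rightarrow> (int \<Rightarrow> 'w \<Rightarrow> nat) \<Rightarrow> nat \<Rightarrow> int \<Rightarrow> 'w \<Rightarrow> nat list" where
  "block n idx t m \<omega> = map (\<lambda>l. idx (int t + int n * m + int l) \<omega>) [0..<n]"

text \<open>For \<open>t < n\<close> the event \<open>T = t\<close> has probability \<open>1 / n > 0\<close>, so conditioning on
  \<open>T\<close> amounts to passing to the measure \<open>U\<close> obtained by conditioning on each such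
  event. A permutation of \<open>1, \<dots>, n\<close> is represented by the list of its values.\<close>

definition random_reshuffling ::
  "nat \<Rightarrow> 'w measure \<Rightarrow> ('w \<Rightarrow> nat) \<Rightarrow> (int \<Rightarrow> 'w \<Rightarrow> nat) \<Rightarrow> bool" where
  "random_reshuffling n M T idx \<longleftrightarrow>
     prob_space M \<and>
     T \<in> measurable M (count_space UNIV) \<and>
     (\<forall>k. idx k \<in> measurable M (count_space {1..n})) \<and>
     distr M (count_space UNIV) T = measure_pmf (pmf_of_set {0..<n}) \<and>
     (\<forall>t<n. let U = uniform_measure M {\<omega> \<in> space M. T \<omega> = t} in
        prob_space.indep_vars U (\<lambda>_. count_space UNIV) (block n idx t) UNIV \<and>
        (\<forall>m. distr U (count_space UNIV) (block n idx t m) =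
              measure_pmf (pmf_of_set (permutations_of_set {1..n}))))"


section \<open>Stationary iterates of SGDM\<close>

definition transfer :: "real \<Rightarrow> real \<Rightarrow> real^'d^'d \<Rightarrow> complex \<Rightarrow> complex^'d^'d" where
  "transfer \<gamma> \<alpha> A z =
     cscale (- of_real \<gamma> * z)
       (matrix_inv (mat (z\<^sup>2) - cscale z (cmatrix (mat (1 + \<alpha>) - \<gamma> *\<^sub>R A)) + mat (of_real \<alpha>)))"

text \<open>These conditions determine \<open>H\<close> uniquely, by uniqueness of Fourier coefficients.\<close>

definition impulse_response ::
  "real \<Rightarrow> real \<Rightarrow> real^'d^'d \<Rightarrow> (int \<Rightarrow> real^'d^'d) \<Rightarrow> bool" where
  "impulse_response \<gamma> \<alpha> A H \<longleftrightarrow>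
     (\<forall>z. cmod z = 1 \<longrightarrow>
        ((\<lambda>k. cscale (z powi (- k)) (cmatrix (H k))) has_sum transfer \<gamma> \<alpha> A z) UNIV)"

definition stationary_sgdm ::
  "nat \<Rightarrow> (nat \<Rightarrow> real^'d^'d) \<Rightarrow> (nat \<Rightarrow> real^'d) \<Rightarrow> real \<Rightarrow> real \<Rightarrow>
   'w measure \<Rightarrow> (int \<Rightarrow> 'w \<Rightarrow> nat) \<Rightarrow> (int \<Rightarrow> 'w \<Rightarrow> real^'d) \<Rightarrow> bool" where
  "stationary_sgdm n A b \<gamma> \<alpha> M idx x \<longleftrightarrow>
     (\<exists>H. impulse_response \<gamma> \<alpha> (mean n A) H \<and>
        (\<forall>k. \<forall>\<omega>\<in>space M. x k \<omega> - minimizer n A b =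
           (\<Sum>\<^sub>\<infinity>j\<in>UNIV. H (k - j) *v noise n A b (idx j \<omega>))))"


section \<open>The spectral density of random reshuffling\<close>

definition rr_formula :: "nat \<Rightarrow> real \<Rightarrow> real" where
  "rr_formula n x =
     real n / (real n - 1) -
     1 / (real n * (real n - 1)) *
       (sin ((real n - 1/2) * x) / sin (x / 2) +
        (sin ((real n - 1) * x / 2))\<^sup>2 / (sin (x / 2))\<^sup>2)"

definition rr_density :: "nat \<Rightarrow> real \<Rightarrow> real" where
  "rr_density n x =
     (if \<exists>k::int. x = 2 * pi * of_int k then Lim (at x) (rr_formula n) else rr_formula n x)"


section \<open>The stationary iterates satisfy the SGDM recursion\<close>

lemma root_sum:
  fixes N :: nat and k :: int
  assumes "N > 0"
  shows "(\<Sum>l<N. cis (2 * pi * real l / real N) powi (-k)) = (if int N dvd k then of_nat N else 0)"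
proof -
  define w where "w = cis (- 2 * pi * of_int k / real N)"
  have e: "cis (2 * pi * real l / real N) powi (-k) = w ^ l" for l
    unfolding w_def by (simp add: cis_power_int Complex.DeMoivre algebra_simps)
  have wN: "w ^ N = 1"
  proof -
    have "w ^ N = cis (2 * pi * of_int (-k))"
      unfolding w_def using assms by (simp add: Complex.DeMoivre)
    also have "\<dots> = 1" by (rule cis_multiple_2pi) simp
    finally show ?thesis .
  qed
  show ?thesis
  proof (cases "int N dvd k")
    case True
    then obtain q where q: "k = int N * q" by blast
    have "w = cis (2 * pi * of_int (-q))" unfolding w_def q using assms by (simp add: mult.assoc)
    also have "\<dots> = 1" by (rule cis_multiple_2pi) simp
    finally show ?thesis using True by (simp add: e)
  next
    case False
    have "w \<noteq> 1"
    proof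
      assume "w = 1"
      then have "cos (- 2 * pi * of_int k / real N) = 1" unfolding w_def
        by (metis cis.simps(1) one_complex.simps(1))
      then obtain q :: int where "- 2 * pi * of_int k / real N = of_int q * 2 * pi"
        using cos_one_2pi_int by blast
      then have "- of_int k = (of_int q * real N :: real)"
        using assms by (simp add: field_simps) (metis mult_cancel_left mult_minus_right pi_neq_zero)
      then have "- k = q * int N" by (metis of_int_eq_iff of_int_minus of_int_mult of_int_of_nat_eq)
      then have "int N dvd k" by (metis dvd_minus_iff dvd_triv_right)
      with False show False by simp
    qed
    then have "(\<Sum>l<N. w ^ l) = 0" using wN by (simp add: geometric_sum)
    then show ?thesis using False by (simp add: e)
  qed
qed

lemma has_sum_finite_sum:
  fixes f :: "nat \<Rightarrow> 'a \<Rightarrow> 'b::{topological_comm_monoid_add}"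
  assumes "\<And>l. l < N \<Longrightarrow> (f l has_sum s l) X"
  shows "((\<lambda>k. \<Sum>l<N. f l k) has_sum (\<Sum>l<N. s l)) X"
  using assms by (induction N) (auto intro: has_sum_add)

lemma has_sum_sum':
  fixes f :: "'c::finite \<Rightarrow> 'a \<Rightarrow> 'b::{topological_comm_monoid_add}"
  assumes "\<And>l. (f l has_sum s l) X"
  shows "((\<lambda>k. \<Sum>l\<in>UNIV. f l k) has_sum (\<Sum>l\<in>UNIV. s l)) X"
proof -
  have "finite Y \<Longrightarrow> ((\<lambda>k. \<Sum>l\<in>Y. f l k) has_sum (\<Sum>l\<in>Y. s l)) X" for Y
    by (induction Y rule: finite_induct) (auto intro: has_sum_add assms)
  then show ?thesis by simp
qed

lemma fourier_zero:
  fixes a :: "int \<Rightarrow> complex"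
  assumes h: "\<And>z. cmod z = 1 \<Longrightarrow> ((\<lambda>k. z powi (-k) * a k) has_sum 0) UNIV"
  shows "a m = 0"
proof -
  define c where "c = (\<lambda>k. a (k + m))"
  have hc: "((\<lambda>k. z powi (-k) * c k) has_sum 0) UNIV" if z: "cmod z = 1" for z
  proof -
    have z0: "z \<noteq> 0" using z by auto
    have "((\<lambda>k. z powi (-(k+m)) * a (k+m)) has_sum 0) UNIV"
      using h[OF z] by (subst has_sum_reindex_bij_witness[where j="\<lambda>k. k+m" and i="\<lambda>k. k-m" and T=UNIV and h="\<lambda>k. z powi (-k) * a k" and s'=0 and s=0]) auto
    from has_sum_cmult_right[OF this, of "z powi m"]
    have "((\<lambda>k. z powi m * (z powi (-(k+m)) * a (k+m))) has_sum 0) UNIV" by simp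
    moreover have "z powi m * (z powi (-(k+m)) * a (k+m)) = z powi (-k) * c k" for k
      using power_int_add[of z m "-(k+m)"] z0 by (simp add: c_def mult.assoc[symmetric])
    ultimately show ?thesis by simp
  qed
  have ca: "(\<lambda>k. norm (c k)) summable_on UNIV"
    using hc[of 1] summable_on_iff_abs_summable_on_complex[of c UNIV]
    by (auto simp: summable_on_def)
  have avg: "((\<lambda>k. if int N dvd k then c k else 0) has_sum 0) UNIV" if N: "N > 0" for N :: nat
  proof -
    have "((\<lambda>k. \<Sum>l<N. cis (2 * pi * real l / real N) powi (-k) * c k) has_sum (\<Sum>l<N. 0)) UNIV"
      by (rule has_sum_finite_sum) (auto intro: hc)
    then have "((\<lambda>k. (if int N dvd k then of_nat N else 0) * c k) has_sum 0) UNIV"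
      by (simp add: sum_distrib_right[symmetric] root_sum[OF N])
    from has_sum_cmult_right[OF this, of "1 / of_nat N"]
    have "((\<lambda>k. 1 / of_nat N * ((if int N dvd k then of_nat N else 0) * c k)) has_sum 0) UNIV" by simp
    moreover have "1 / of_nat N * ((if int N dvd k then of_nat N else 0) * c k) = (if int N dvd k then c k else 0)" for k
      using N by simp
    ultimately show ?thesis by simp
  qed
  have "norm (c 0) \<le> e" if e: "e > 0" for e :: real
  proof -
    obtain F where F: "finite F" "dist (sum (\<lambda>k. norm (c k)) F) (infsum (\<lambda>k. norm (c k)) UNIV) \<le> e"
      using infsum_finite_approximation[OF ca e] by auto
    define N where "N = nat (Max (insert 0 (abs ` F))) + 1"
    have small: "\<bar>k\<bar> < int N" if "k \<in> F" for k
    proof -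
      have "\<bar>k\<bar> \<le> Max (insert 0 (abs ` F))" using F that by (intro Max_ge) auto
      then show ?thesis unfolding N_def by linarith
    qed
    have ndvd: "\<not> int N dvd k" if "k \<in> F" "k \<noteq> 0" for k
      using small[OF that(1)] dvd_imp_le_int[OF that(2), of "int N"] by auto
    have Npos: "N > 0" unfolding N_def by simp
    define g where "g = (\<lambda>k. if int N dvd k then c k else 0)"
    have g: "(g has_sum 0) UNIV" using avg[OF Npos] unfolding g_def .
    have g1: "(g has_sum (0 - g 0)) (UNIV - {0})"
      by (rule has_sum_Diff[OF g]) (auto intro: has_sum_finiteI)
    have gF: "(g has_sum (0 - g 0)) (UNIV - F - {0})"
    proof (rule has_sum_cong_neutral[THEN iffD1, OF _ _ _ g1])
      show "g x = 0" if "x \<in> (UNIV - {0}) - (UNIV - F - {0})" for x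
        using that ndvd[of x] by (auto simp: g_def)
    qed auto
    have cF: "((\<lambda>k. norm (c k)) has_sum (infsum (\<lambda>k. norm (c k)) UNIV - sum (\<lambda>k. norm (c k)) F)) (UNIV - F)"
      by (rule has_sum_Diff) (use ca F in \<open>auto intro: has_sum_finiteI\<close>)
    have sub: "(\<lambda>k. norm (c k)) summable_on (UNIV - F - {0})"
      using ca by (rule summable_on_subset) simp
    have sub2: "(\<lambda>k. norm (g k)) summable_on (UNIV - F - {0})"
      by (rule Infinite_Sum.abs_summable_on_comparison_test[OF sub]) (auto simp: g_def)
    have "norm (0 - g 0) \<le> infsum (\<lambda>k. norm (g k)) (UNIV - F - {0})"
      by (rule norm_has_sum_bound[OF _ gF]) (use sub2 in auto)
    also have "\<dots> \<le> infsum (\<lambda>k. norm (c k)) (UNIV - F)"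
      by (rule infsum_mono_neutral[OF sub2 has_sum_imp_summable[OF cF]]) (auto simp: g_def)
    also have "\<dots> = infsum (\<lambda>k. norm (c k)) UNIV - sum (\<lambda>k. norm (c k)) F"
      using cF by (rule infsumI)
    also have "\<dots> \<le> e" using F(2) by (simp add: dist_real_def)
    finally show ?thesis by (simp add: g_def)
  qed
  then have "norm (c 0) \<le> 0" by (rule field_le_epsilon) simp
  then show ?thesis by (simp add: c_def)
qed


lemma cmatrix_nth [simp]: "cmatrix M $ i $ j = complex_of_real (M $ i $ j)"
  by (simp add: cmatrix_def)

lemma cscale_nth [simp]: "cscale c M $ i $ j = c * M $ i $ j"
  by (simp add: cscale_def)

lemma transfer_invertible:
  fixes A :: "real^'d^'d"
  assumes A: "pos_def A" and \<gamma>: "\<gamma> > 0" and \<alpha>: "0 \<le> \<alpha>" "\<alpha> < 1"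
    and B: "pos_semidef (mat (1 + \<alpha>) - \<gamma> *\<^sub>R A)" and z: "cmod z = 1"
  shows "invertible (mat (z\<^sup>2) - cscale z (cmatrix (mat (1 + \<alpha>) - \<gamma> *\<^sub>R A)) + mat (of_real \<alpha>))"
    (is "invertible ?Q")
proof -
  define B where "B = mat (1 + \<alpha>) - \<gamma> *\<^sub>R A"
  have sym: "p \<bullet> (B *v q) = q \<bullet> (B *v p)" for p q
  proof -
    have "transpose B = B" using assms(5) by (simp add: B_def pos_semidef_def)
    then have "p v* B = B *v p" using transpose_matrix_vector[of B p] by simp
    then show ?thesis using dot_lmul_matrix[of p B q] by (simp add: inner_commute)
  qed
  have Bv: "p \<bullet> (B *v p) = (1 + \<alpha>) * (p \<bullet> p) - \<gamma> * (p \<bullet> (A *v p))" for p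
  proof -
    have "mat (1 + \<alpha>) *v p = (1 + \<alpha>) *\<^sub>R p"
      by (simp add: vec_eq_iff matrix_vector_mult_def mat_def if_distrib[of "\<lambda>x. x * _"] cong: if_cong)
    then show ?thesis unfolding B_def
      by (simp add: matrix_vector_mult_diff_rdistrib scaleR_matrix_vector_assoc[symmetric] inner_diff_right)
  qed
  have inj: "v = 0" if v: "?Q *v v = 0" for v
  proof -
    define p q where "p = (\<chi> i. Re (v $ i))" and "q = (\<chi> i. Im (v $ i))"
    define c where "c = z + of_real \<alpha> * cnj z"
    have zc: "z * cnj z = 1" using z by (simp add: complex_norm_square[symmetric])
    have comp: "(\<Sum>j\<in>UNIV. of_real (B $ i $ j) * v $ j) = c * v $ i" for i
    proof -
      have "0 = (?Q *v v) $ i" using v by simp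
      also have "\<dots> = (\<Sum>j\<in>UNIV. (if i = j then z\<^sup>2 + of_real \<alpha> else 0) * v $ j - z * (of_real (B $ i $ j) * v $ j))"
        by (auto simp: matrix_vector_mult_def B_def mat_def algebra_simps intro!: sum.cong)
      also have "\<dots> = (z\<^sup>2 + of_real \<alpha>) * v $ i - z * (\<Sum>j\<in>UNIV. of_real (B $ i $ j) * v $ j)"
        by (simp add: sum_subtractf sum_distrib_left if_distrib[of "\<lambda>x. x * _"] cong: if_cong)
      finally have "cnj z * (z * (\<Sum>j\<in>UNIV. of_real (B $ i $ j) * v $ j)) = cnj z * ((z\<^sup>2 + of_real \<alpha>) * v $ i)"
        by simp
      then have "(z * cnj z) * (\<Sum>j\<in>UNIV. of_real (B $ i $ j) * v $ j) = (z * (z * cnj z) + of_real \<alpha> * cnj z) * v $ i"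
        by (simp add: power2_eq_square algebra_simps)
      then show ?thesis unfolding zc c_def by simp
    qed
    have Bp: "B *v p = Re c *\<^sub>R p - Im c *\<^sub>R q"
      using arg_cong[OF comp, of Re] by (simp add: vec_eq_iff matrix_vector_mult_def p_def q_def)
    have Bq: "B *v q = Im c *\<^sub>R p + Re c *\<^sub>R q"
      using arg_cong[OF comp, of Im] by (simp add: vec_eq_iff matrix_vector_mult_def p_def q_def)
    show "v = 0"
    proof (rule ccontr)
      assume "v \<noteq> 0"
      then have pq: "p \<noteq> 0 \<or> q \<noteq> 0"
        by (auto simp: vec_eq_iff p_def q_def complex_eq_iff)
      then have pos: "p \<bullet> p + q \<bullet> q > 0"

        by (auto intro: add_nonneg_pos add_pos_nonneg)
      have "Im c * (p \<bullet> p + q \<bullet> q) = 0"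
        using sym[of q p] unfolding Bp Bq by (simp add: algebra_simps inner_commute)
      then have ic: "Im c = 0" using pos by simp
      then have "Im z = 0" using \<alpha> by (simp add: c_def algebra_simps)
      then have "Re z = 1 \<or> Re z = -1" using z
        by (auto simp: cmod_def power2_eq_square abs_if split: if_splits)
      then have rc: "Re c = 1 + \<alpha> \<or> Re c = - (1 + \<alpha>)" by (auto simp: c_def)
      have key: "w = 0" if "B *v w = Re c *\<^sub>R w" for w
      proof (rule ccontr)
        assume "w \<noteq> 0"
        then have "w \<bullet> w > 0" "w \<bullet> (A *v w) > 0" using A by (auto simp: pos_def_def)
        moreover have "w \<bullet> (B *v w) \<ge> 0" using assms(5) by (simp add: B_def pos_semidef_def)
        moreover have "w \<bullet> (B *v w) = Re c * (w \<bullet> w)" using that by simp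
        moreover have "(1 + \<alpha>) * (w \<bullet> w) > 0" using \<alpha> \<open>w \<bullet> w > 0\<close> by simp
        moreover have "\<gamma> * (w \<bullet> (A *v w)) > 0" using \<gamma> \<open>w \<bullet> (A *v w) > 0\<close> by simp
        ultimately show False 
        proof -
          assume h: "0 < w \<bullet> w" "0 \<le> w \<bullet> (B *v w)" "w \<bullet> (B *v w) = Re c * (w \<bullet> w)"
            "0 < (1 + \<alpha>) * (w \<bullet> w)" "0 < \<gamma> * (w \<bullet> (A *v w))"
          from rc show False
          proof
            assume "Re c = 1 + \<alpha>"
            then have "w \<bullet> (B *v w) = (1 + \<alpha>) * (w \<bullet> w)" using h(3) by (simp only:)
            then show False using h Bv[of w] by linarith
          next
            assume "Re c = - (1 + \<alpha>)"
            then have "w \<bullet> (B *v w) = - ((1 + \<alpha>) * (w \<bullet> w))" using h(3) by (simp only: minus_mult_left)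
            then show False using h by linarith
          qed
        qed
      qed
      have "B *v p = Re c *\<^sub>R p" "B *v q = Re c *\<^sub>R q" using Bp Bq ic by simp_all
      from key[OF this(1)] key[OF this(2)]
      show False using pq by simp
    qed
  qed
  have "\<exists>R. R ** ?Q = mat 1" unfolding matrix_left_invertible_ker by (intro allI impI) (rule inj)
  then show ?thesis by (simp only: invertible_left_inverse)
qed

lemma matrix_norm_le:
  fixes M :: "real^'d^'e"
  shows "norm M \<le> (\<Sum>i\<in>UNIV. \<Sum>j\<in>UNIV. \<bar>M $ i $ j\<bar>)"
proof -
  have "norm M \<le> (\<Sum>i\<in>UNIV. norm (M $ i))" unfolding norm_vec_def by (rule L2_set_le_sum) simp
  also have "\<dots> \<le> (\<Sum>i\<in>UNIV. \<Sum>j\<in>UNIV. \<bar>M $ i $ j\<bar>)" by (intro sum_mono norm_le_l1_cart)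
  finally show ?thesis .
qed

lemma impulse_response_entry:
  fixes A :: "real^'d^'d"
  assumes "impulse_response \<gamma> \<alpha> A H" "cmod z = 1"
  shows "((\<lambda>k. z powi (-k) * of_real (H k $ i $ j)) has_sum transfer \<gamma> \<alpha> A z $ i $ j) UNIV"
proof -
  have bl: "bounded_linear (\<lambda>M :: complex^'d^'d. M $ i $ j)"
    by (intro bounded_linear_compose[OF bounded_linear_vec_nth bounded_linear_vec_nth])
  show ?thesis
    using has_sum_bounded_linear[OF bl, of "\<lambda>k. cscale (z powi (-k)) (cmatrix (H k))"] assms
    by (simp add: impulse_response_def)
qed

lemma impulse_response_summable:
  assumes "impulse_response \<gamma> \<alpha> A H"
  shows "(\<lambda>k. norm (H k)) summable_on UNIV"
proof -
  have "(\<lambda>k. \<bar>H k $ i $ j\<bar>) summable_on UNIV" for i j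
  proof -
    have "(\<lambda>k. complex_of_real (H k $ i $ j)) summable_on UNIV"
      using impulse_response_entry[OF assms, of 1 i j] by (auto simp: summable_on_def)
    then show ?thesis by (simp add: summable_on_iff_abs_summable_on_complex)
  qed
  then have "((\<lambda>k. \<bar>H k $ i $ j\<bar>) has_sum infsum (\<lambda>k. \<bar>H k $ i $ j\<bar>) UNIV) UNIV" for i j
    by (rule has_sum_infsum)
  note hh = this
  have "((\<lambda>k. \<Sum>i\<in>UNIV. \<Sum>j\<in>UNIV. \<bar>H k $ i $ j\<bar>) has_sum
     (\<Sum>i\<in>UNIV. \<Sum>j\<in>UNIV. infsum (\<lambda>k. \<bar>H k $ i $ j\<bar>) UNIV)) UNIV"
    by (intro has_sum_sum' hh)
  then have "(\<lambda>k. \<Sum>i\<in>UNIV. \<Sum>j\<in>UNIV. \<bar>H k $ i $ j\<bar>) summable_on UNIV"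
    unfolding summable_on_def by blast
  then show ?thesis
    by (rule summable_on_comparison_test) (auto intro: matrix_norm_le)
qed

lemma impulse_response_recursion:
  fixes A :: "real^'d^'d"
  assumes A: "pos_def A" and \<gamma>: "\<gamma> > 0" and \<alpha>: "0 \<le> \<alpha>" "\<alpha> < 1"
    and B: "pos_semidef (mat (1 + \<alpha>) - \<gamma> *\<^sub>R A)" and H: "impulse_response \<gamma> \<alpha> A H"
  shows "H (k + 1) = (mat (1 + \<alpha>) - \<gamma> *\<^sub>R A) ** H k - \<alpha> *\<^sub>R H (k - 1) - (if k = 0 then mat \<gamma> else 0)"
proof -
  define B where "B = mat (1 + \<alpha>) - \<gamma> *\<^sub>R A"
  define E where "E = (\<lambda>k. H (k+1) - B ** H k + \<alpha> *\<^sub>R H (k-1) + (if k = 0 then mat \<gamma> else 0))"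
  have "complex_of_real (E k $ i $ j) = 0" for i j
  proof (rule fourier_zero)
    fix z :: complex assume z: "cmod z = 1"
    have z0: "z \<noteq> 0" using z by auto
    define S where "S = transfer \<gamma> \<alpha> A z"
    define Q where "Q = mat (z\<^sup>2) - cscale z (cmatrix B) + mat (of_real \<alpha>)"
    have QS: "Q ** S = mat (- of_real \<gamma> * z)"
    proof -
      have "Q ** matrix_inv Q = mat 1"
        using transfer_invertible[OF assms(1-5) z] unfolding Q_def B_def
        unfolding invertible_def matrix_inv_def by (rule someI2_ex) simp
      moreover have "Q ** cscale c X = cscale c (Q ** X)" for c X
        by (simp add: vec_eq_iff matrix_matrix_mult_def sum_distrib_left mult_ac)
      moreover have "S = cscale (- of_real \<gamma> * z) (matrix_inv Q)"
        by (simp add: S_def transfer_def Q_def B_def)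
      ultimately have "Q ** S = cscale (- of_real \<gamma> * z) (mat 1)" by simp
      then show ?thesis by (simp add: vec_eq_iff mat_def)
    qed
    note hs = impulse_response_entry[OF H z, folded S_def]
    have s1: "((\<lambda>k. z powi (-k) * (of_real (H (k+1) $ i $ j))) has_sum z * S $ i $ j) UNIV"
    proof -
      have "((\<lambda>k. z powi (-(k+1)) * of_real (H (k+1) $ i $ j)) has_sum S $ i $ j) UNIV"
        using hs[of i j] by (subst has_sum_reindex_bij_witness[where j="\<lambda>k. k+1" and i="\<lambda>k. k-1" and T=UNIV and h="\<lambda>k. z powi (-k) * of_real (H k $ i $ j)" and s'="S $ i $ j" and s="S $ i $ j"]) auto
      from has_sum_cmult_right[OF this, of z]
      have "((\<lambda>k. z * (z powi (-(k+1)) * of_real (H (k+1) $ i $ j))) has_sum z * S $ i $ j) UNIV" .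
      moreover have "z * (z powi (-(k+1)) * w) = z powi (-k) * w" for k w
        using power_int_add[of z 1 "-(k+1)"] z0 by (simp add: mult.assoc[symmetric])
      ultimately show ?thesis by (simp only:)
    qed
    have s2: "((\<lambda>k. z powi (-k) * (of_real (H (k-1) $ i $ j))) has_sum (cnj z * S $ i $ j)) UNIV"
    proof -
      have zc: "cnj z = inverse z" 
        using inverse_unique[of z "cnj z"] z by (simp add: complex_norm_square[symmetric])
      have "((\<lambda>k. z powi (-(k-1)) * of_real (H (k-1) $ i $ j)) has_sum S $ i $ j) UNIV"
        using hs[of i j] by (subst has_sum_reindex_bij_witness[where j="\<lambda>k. k-1" and i="\<lambda>k. k+1" and T=UNIV and h="\<lambda>k. z powi (-k) * of_real (H k $ i $ j)" and s'="S $ i $ j" and s="S $ i $ j"]) auto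
      from has_sum_cmult_right[OF this, of "inverse z"]
      have "((\<lambda>k. inverse z * (z powi (-(k-1)) * of_real (H (k-1) $ i $ j))) has_sum inverse z * S $ i $ j) UNIV" .
      moreover have "inverse z * (z powi (-(k-1)) * w) = z powi (-k) * w" for k w
        using power_int_add[of z "-1" "-(k-1)"] z0 by (simp add: mult.assoc[symmetric] power_int_minus)
      ultimately show ?thesis unfolding zc by (simp only:)
    qed
    have s3: "((\<lambda>k. z powi (-k) * of_real ((B ** H k) $ i $ j)) has_sum (\<Sum>l\<in>UNIV. of_real (B $ i $ l) * S $ l $ j)) UNIV"
    proof -
      have "((\<lambda>k. \<Sum>l\<in>UNIV. of_real (B $ i $ l) * (z powi (-k) * of_real (H k $ l $ j))) has_sum (\<Sum>l\<in>UNIV. of_real (B $ i $ l) * S $ l $ j)) UNIV"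
        by (rule has_sum_sum') (auto intro!: has_sum_cmult_right hs)
      then show ?thesis
        by (simp add: matrix_matrix_mult_def sum_distrib_left mult_ac)
    qed
    have s4: "((\<lambda>k. z powi (-k) * of_real ((if k = 0 then mat \<gamma> else 0) $ i $ j)) has_sum of_real (mat \<gamma> $ i $ j)) UNIV"
      by (rule has_sum_finite_neutralI[of "{0}"]) auto
    have "((\<lambda>k. z powi (-k) * of_real (H (k+1) $ i $ j) + (- 1) * (z powi (-k) * of_real ((B ** H k) $ i $ j))
        + of_real \<alpha> * (z powi (-k) * of_real (H (k-1) $ i $ j)) + z powi (-k) * of_real ((if k = 0 then mat \<gamma> else 0) $ i $ j))
       has_sum (z * S $ i $ j + (-1) * (\<Sum>l\<in>UNIV. of_real (B $ i $ l) * S $ l $ j)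
        + of_real \<alpha> * (cnj z * S $ i $ j) + of_real (mat \<gamma> $ i $ j))) UNIV" (is "(_ has_sum ?s) _")
      by (intro has_sum_add has_sum_cmult_right s1 s2 s3 s4)
    moreover have "?s = 0"
    proof -
      have zc: "z * cnj z = 1" using z by (simp add: complex_norm_square[symmetric])
      have "(Q ** S) $ i $ j = (\<Sum>l\<in>UNIV. (if i = l then z\<^sup>2 + of_real \<alpha> else 0) * S $ l $ j - z * (of_real (B $ i $ l) * S $ l $ j))"
        by (auto simp: matrix_matrix_mult_def Q_def mat_def algebra_simps intro!: sum.cong)
      also have "\<dots> = (z\<^sup>2 + of_real \<alpha>) * S $ i $ j - z * (\<Sum>l\<in>UNIV. of_real (B $ i $ l) * S $ l $ j)"
        by (simp add: sum_subtractf sum_distrib_left if_distrib[of "\<lambda>x. x * _"] cong: if_cong)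
      finally have "(z\<^sup>2 + of_real \<alpha>) * S $ i $ j - z * (\<Sum>l\<in>UNIV. of_real (B $ i $ l) * S $ l $ j) = - z * of_real (mat \<gamma> $ i $ j)"
        unfolding QS by (auto simp add: mat_def mult.commute split: if_splits)
      moreover have "z * ?s = (z\<^sup>2 + of_real \<alpha> * (z * cnj z)) * S $ i $ j - z * (\<Sum>l\<in>UNIV. of_real (B $ i $ l) * S $ l $ j) + z * of_real (mat \<gamma> $ i $ j)"
        by (simp add: algebra_simps power2_eq_square)
      ultimately have "z * ?s = 0" unfolding zc by simp
      then show ?thesis using z0 by simp
    qed
    moreover have "z powi (-k) * of_real (H (k+1) $ i $ j) + (- 1) * (z powi (-k) * of_real ((B ** H k) $ i $ j))
        + of_real \<alpha> * (z powi (-k) * of_real (H (k-1) $ i $ j)) + z powi (-k) * of_real ((if k = 0 then mat \<gamma> else 0) $ i $ j)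
       = z powi (-k) * complex_of_real (E k $ i $ j)" for k
      unfolding E_def by (simp add: algebra_simps)
    ultimately show "((\<lambda>k. z powi (-k) * complex_of_real (E k $ i $ j)) has_sum 0) UNIV"
      by (simp only:)
  qed
  then have "E k = 0" by (simp add: vec_eq_iff)
  then show ?thesis unfolding E_def B_def by (auto simp: algebra_simps)
qed


lemma norm_matrix_vector_le:
  fixes M :: "real^'d^'d"
  shows "norm (M *v v) \<le> (real CARD('d) * real CARD('d) * norm M) * norm v"
proof -
  have "norm (M *v v) \<le> onorm ((*v) M) * norm v"
    by (rule onorm) (simp add: matrix_vector_mul_bounded_linear)
  also have "onorm ((*v) M) \<le> real CARD('d) * real CARD('d) * norm M"
  proof (rule onorm_le_matrix_component)
    show "\<bar>M $ i $ j\<bar> \<le> norm M" for i j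

      using component_le_norm_cart[of "M $ i" j] Finite_Cartesian_Product.norm_nth_le[of M i] by simp
  qed
  finally show ?thesis by (simp add: mult_right_mono)
qed

text \<open>The stationary iterates, defined in closed form by filtering the noise, run SGDM with the
  noisy gradients at every outcome.\<close>

theorem stationary_sgdm_recursion:
  fixes A :: "nat \<Rightarrow> real^'d^'d"
  assumes A: "pos_def (mean n A)" and \<gamma>: "\<gamma> > 0" and \<alpha>: "0 \<le> \<alpha>" "\<alpha> < 1"
    and B: "pos_semidef (mat (1 + \<alpha>) - \<gamma> *\<^sub>R mean n A)"
    and rr: "random_reshuffling n M T idx"
    and x: "stationary_sgdm n A b \<gamma> \<alpha> M idx x"
    and \<omega>: "\<omega> \<in> space M"
  shows "x (k + 1) \<omega> =
    x k \<omega> + \<alpha> *\<^sub>R (x k \<omega> - x (k - 1) \<omega>) - \<gamma> *\<^sub>R noisy_grad n A b (idx k \<omega>) (x k \<omega>)"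
proof -
  obtain H where H: "impulse_response \<gamma> \<alpha> (mean n A) H"
    and xH: "\<And>k. x k \<omega> - minimizer n A b = (\<Sum>\<^sub>\<infinity>j. H (k - j) *v noise n A b (idx j \<omega>))"
    using x \<omega> unfolding stationary_sgdm_def by auto
  define y where "y = (\<lambda>j. noise n A b (idx j \<omega>))"
  define D where "D = (\<lambda>k. x k \<omega> - minimizer n A b)"
  define B where "B = mat (1 + \<alpha>) - \<gamma> *\<^sub>R mean n A"
  define C where "C = Max (insert 0 ((\<lambda>i. norm (noise n A b i)) ` {1..n}))"
  have yC: "norm (y j) \<le> C" for j
  proof -
    have "idx j \<omega> \<in> {1..n}" using rr \<omega> unfolding random_reshuffling_def
      by (auto dest!: spec[of _ j] measurable_space)
    then show ?thesis unfolding C_def y_def by (intro Max_ge) auto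
  qed
  define K where "K = real CARD('d) * real CARD('d)"
  have K: "K \<ge> 0" unfolding K_def by simp
  have D: "((\<lambda>j. H (k - j) *v y j) has_sum D k) UNIV" for k
  proof -
    have "(\<lambda>j. norm (H (k - j))) summable_on UNIV"
      using impulse_response_summable[OF H]
      by (subst summable_on_reindex_bij_witness[where j="\<lambda>j. k-j" and i="\<lambda>j. k-j" and T=UNIV and h="\<lambda>j. norm (H j)"]) auto
    then have "(\<lambda>j. (K * C) * norm (H (k - j))) summable_on UNIV"
      by (rule summable_on_cmult_right)
    moreover have "norm (H (k - j) *v y j) \<le> (K * C) * norm (H (k - j))" for j
    proof -
      have "norm (H (k - j) *v y j) \<le> (K * norm (H (k - j))) * norm (y j)"
        unfolding K_def by (rule norm_matrix_vector_le)
      also have "\<dots> \<le> (K * norm (H (k - j))) * C"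
        using K yC by (intro mult_left_mono) auto
      finally show ?thesis by (simp add: mult_ac)
    qed
    ultimately have "(\<lambda>j. norm (H (k - j) *v y j)) summable_on UNIV"
      by (rule summable_on_comparison_test) auto
    then have "(\<lambda>j. H (k - j) *v y j) summable_on UNIV"
      by (rule abs_summable_summable)
    then show ?thesis using xH[of k] unfolding D_def y_def by (simp add: has_sum_infsum)
  qed
  have rec: "H (k + 1 - j) *v y j = B *v (H (k - j) *v y j) + (- \<alpha>) *\<^sub>R (H (k - 1 - j) *v y j)
      + (if j = k then - \<gamma> *\<^sub>R y j else 0)" for j
  proof -
    have e: "k + 1 - j = (k - j) + 1" "k - 1 - j = (k - j) - 1" by auto
    have "mat \<gamma> *v y j = \<gamma> *\<^sub>R y j"
      by (simp add: vec_eq_iff matrix_vector_mult_def mat_def if_distrib[of "\<lambda>x. x * _"] cong: if_cong)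
    then show ?thesis
      unfolding e impulse_response_recursion[OF assms(1-5) H, of "k - j"] B_def
      by (auto simp: matrix_vector_mult_diff_rdistrib matrix_vector_mul_assoc scaleR_matrix_vector_assoc[symmetric])
  qed
  have "((\<lambda>j. B *v (H (k - j) *v y j) + (- \<alpha>) *\<^sub>R (H (k - 1 - j) *v y j)
      + (if j = k then - \<gamma> *\<^sub>R y j else 0)) has_sum (B *v D k + (- \<alpha>) *\<^sub>R D (k - 1) + (- \<gamma> *\<^sub>R y k))) UNIV"
  proof (intro has_sum_add)
    show "((\<lambda>j. B *v (H (k - j) *v y j)) has_sum B *v D k) UNIV"
      by (rule has_sum_bounded_linear[OF matrix_vector_mul_bounded_linear D])
    show "((\<lambda>j. (- \<alpha>) *\<^sub>R (H (k - 1 - j) *v y j)) has_sum (- \<alpha>) *\<^sub>R D (k - 1)) UNIV"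
      by (rule has_sum_scaleR[OF D])
    show "((\<lambda>j. if j = k then - \<gamma> *\<^sub>R y j else 0) has_sum - \<gamma> *\<^sub>R y k) UNIV"
      by (rule has_sum_finite_neutralI[of "{k}"]) auto
  qed
  then have "D (k + 1) = B *v D k - \<alpha> *\<^sub>R D (k - 1) - \<gamma> *\<^sub>R y k"
    using has_sum_unique[OF D[of "k+1"]] unfolding rec by simp
  moreover have "B *v D k = (1 + \<alpha>) *\<^sub>R D k - \<gamma> *\<^sub>R (mean n A *v D k)"
  proof -
    have "mat (1 + \<alpha>) *v D k = (1 + \<alpha>) *\<^sub>R D k"
      by (simp add: vec_eq_iff matrix_vector_mult_def mat_def if_distrib[of "\<lambda>x. x * _"] cong: if_cong)
    then show ?thesis unfolding B_def
      by (simp add: matrix_vector_mult_diff_rdistrib scaleR_matrix_vector_assoc[symmetric])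
  qed
  moreover have "mean n A *v minimizer n A b = - mean n b"
  proof -
    have "v = 0" if "mean n A *v v = 0" for v

      using A that unfolding pos_def_def by force
    then have "\<exists>R. R ** mean n A = mat 1"
      unfolding matrix_left_invertible_ker by blast
    then have "invertible (mean n A)"
      by (simp only: invertible_left_inverse)
    then have "mean n A ** matrix_inv (mean n A) = mat 1"
      unfolding invertible_def matrix_inv_def by (rule someI2_ex) simp
    then show ?thesis unfolding minimizer_def
      by (simp add: matrix_vector_mul_assoc linear_neg)
  qed
  ultimately have "D (k + 1) = (1 + \<alpha>) *\<^sub>R D k - \<gamma> *\<^sub>R (mean n A *v x k \<omega> + mean n b)
      - \<alpha> *\<^sub>R D (k - 1) - \<gamma> *\<^sub>R y k"
    by (simp add: D_def matrix_vector_mult_diff_distrib)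
  then show ?thesis
    unfolding noisy_grad_def D_def y_def by (simp add: algebra_simps)
qed

end

(* A left eigenvector u of A with eigenvalue l is a left eigenvector of every transfer matrix, hence,
   by uniqueness of Fourier coefficients, of every H_k. So each coordinate u . (x_k - x_star) is a
   scalar filter h of the scalar noise v_j = u . y_(i_j), with transfer function g of modulus
   gamma / |z^2 - z (1 + alpha - gamma l) + alpha|. Averaging over T, the noise has autocovariance
   (u . Sigma u) rho(j - l) with rho(m) = n/(n-1) [m = 0] - max(0, n - |m|) / (n (n-1)), because
   n - |m| of the n values of T put two indices at distance m into one block. The Fejer kernel is a
   sum of Dirichlet kernels, so r_n is a trigonometric polynomial and rho(m) is its m-th Fourier
   coefficient. For finitely many h_j the variance identity is therefore linear algebra, and dominated
   convergence on both sides yields the general case. *)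

theory Submission
  imports Defs "HOL-Combinatorics.Permutations"
begin

section \<open>The spectral density as a trigonometric polynomial\<close>

text \<open>The sum runs over both signs: this is the sum of exp(i j x), whose sine parts cancel.
  Integer indices let a frequency \<open>m\<close> be matched against \<open>j\<close>
  directly.\<close>

definition dirichlet_kernel :: "nat \<Rightarrow> real \<Rightarrow> real" where
  "dirichlet_kernel k x = (\<Sum>j\<in>{- int k..int k}. cos (of_int j * x))"

lemma dirichlet_kernel_0 [simp]: "dirichlet_kernel 0 x = 1"
  by (simp add: dirichlet_kernel_def)

lemma dirichlet_kernel_Suc:
  "dirichlet_kernel (Suc k) x = dirichlet_kernel k x + 2 * cos (real (Suc k) * x)"
proof -
  have "{- int (Suc k)..int (Suc k)} =
      insert (- int (Suc k)) (insert (int (Suc k)) {- int k..int k})"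
    by auto
  then have "dirichlet_kernel (Suc k) x =
      cos (of_int (- int (Suc k)) * x) + (cos (of_int (int (Suc k)) * x) + dirichlet_kernel k x)"
    unfolding dirichlet_kernel_def by (subst \<open>{- int (Suc k)..int (Suc k)} = _\<close>) simp
  moreover have "cos (of_int (- int (Suc k)) * x) = cos (real (Suc k) * x)"
    by (metis cos_minus minus_mult_left of_int_minus of_int_of_nat_eq)
  ultimately show ?thesis by simp
qed

text \<open>Telescoping: multiplied by sin(x/2), each new term 2 cos((k+1) x) is the difference of
  sin((k+3/2) x) and sin((k+1/2) x). The multiplied form also holds where sin(x/2) vanishes.\<close>

lemma sin_times_dirichlet_kernel:
  "sin (x / 2) * dirichlet_kernel k x = sin ((real k + 1/2) * x)"
proof (induction k)
  case (Suc k)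
  have "sin ((real (Suc k) + 1/2) * x) - sin ((real k + 1/2) * x) =
      2 * sin (x / 2) * cos (real (Suc k) * x)"
  proof -
    have "((real (Suc k) + 1/2) * x - (real k + 1/2) * x) / 2 = x / 2"
      "((real (Suc k) + 1/2) * x + (real k + 1/2) * x) / 2 = real (Suc k) * x"
      by (simp_all add: field_simps)
    then show ?thesis by (simp only: sin_diff_sin)
  qed
  with Suc show ?case by (simp add: dirichlet_kernel_Suc algebra_simps)
qed simp

text \<open>The Fejer kernel identity. Consecutive squares differ by sin(a-b) sin(a+b) with a - b =
  x/2 and a + b = (n+1/2) x, which is sin(x/2)^2 times the next Dirichlet kernel.\<close>

lemma sin_squared_times_sum_dirichlet_kernel:
  "(sin (x / 2))\<^sup>2 * (\<Sum>k<n. dirichlet_kernel k x) = (sin (real n * x / 2))\<^sup>2"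
proof (induction n)
  case (Suc n)
  have "(sin (real (Suc n) * x / 2))\<^sup>2 - (sin (real n * x / 2))\<^sup>2
      = sin (x / 2) * sin ((real n + 1/2) * x)"
  proof -
    define a b where "a = real (Suc n) * x / 2" and "b = real n * x / 2"
    have "x / 2 = a - b" "(real n + 1/2) * x = a + b" by (simp_all add: a_def b_def field_simps)
    then have "sin (x / 2) * sin ((real n + 1/2) * x) =
        (sin a * cos b)\<^sup>2 - (cos a * sin b)\<^sup>2"
      unfolding \<open>x / 2 = a - b\<close> \<open>(real n + 1/2) * x = a + b\<close>
      by (simp add: sin_add sin_diff power2_eq_square algebra_simps)
    also have "\<dots> = (sin a)\<^sup>2 - (sin b)\<^sup>2"
      by (simp add: power_mult_distrib cos_squared_eq algebra_simps)
    finally show ?thesis by (simp add: a_def b_def)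
  qed
  also have "\<dots> = (sin (x / 2))\<^sup>2 * dirichlet_kernel n x"
    by (simp add: sin_times_dirichlet_kernel[symmetric] power2_eq_square)
  finally show ?case using Suc.IH by (simp add: distrib_left)
qed simp

text \<open>\<open>rr_formula\<close> with its singularities removed: a trigonometric polynomial of
  degree below \<open>n\<close>, hence continuous everywhere.\<close>

definition rr_poly :: "nat \<Rightarrow> real \<Rightarrow> real" where
  "rr_poly n x = real n / (real n - 1)
     - 1 / (real n * (real n - 1)) * (\<Sum>k<n. dirichlet_kernel k x)"

lemma continuous_on_rr_poly [continuous_intros]: "continuous_on X (rr_poly n)"
  unfolding rr_poly_def dirichlet_kernel_def by (intro continuous_intros)

text \<open>With n = m + 1, the first quotient is the Dirichlet kernel of index \<open>m\<close> and
  the second is the sum of those of index below \<open>m\<close>; together they make up the sum over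
  all k < n.\<close>

lemma rr_formula_eq_rr_poly:
  assumes "n > 0" "sin (x / 2) \<noteq> 0"
  shows "rr_formula n x = rr_poly n x"
proof -
  obtain m where n: "n = Suc m" using assms(1) by (cases n) auto
  have "sin ((real n - 1/2) * x) / sin (x / 2) = dirichlet_kernel m x"
    using sin_times_dirichlet_kernel[of x m] assms(2) by (simp add: n field_simps)
  moreover have "(sin ((real n - 1) * x / 2))\<^sup>2 / (sin (x / 2))\<^sup>2 = (\<Sum>k<m. dirichlet_kernel k x)"
    using sin_squared_times_sum_dirichlet_kernel[of x m] assms(2) by (simp add: n field_simps)
  ultimately show ?thesis unfolding rr_formula_def rr_poly_def by (simp add: n add.commute)
qed

text \<open>At a multiple of 2 pi the formula agrees with a continuous function on a punctured
  neighbourhood, so the limit in \<open>rr_density\<close> exists and is the value of that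
  function.\<close>

lemma rr_density_eq_rr_poly:
  assumes "n > 0"
  shows "rr_density n x = rr_poly n x"
proof (cases "\<exists>k::int. x = 2 * pi * of_int k")
  case True
  then obtain k :: int where k: "x = 2 * pi * of_int k" by blast
  \<comment> \<open>The zeros of sin(y/2) are 2 pi apart, so this ball contains none of them besides
    its centre.\<close>
  have "\<forall>\<^sub>F y in at x. y \<in> ball x (2 * pi) \<and> y \<noteq> x"
    by (intro eventually_conj eventually_at_in_open' eventually_neq_at_within) auto
  then have "\<forall>\<^sub>F y in at x. rr_poly n y = rr_formula n y"
  proof eventually_elim
    case (elim y)
    have "sin (y / 2) \<noteq> 0"
    proof
      assume "sin (y / 2) = 0"
      then obtain i :: int where "y / 2 = of_int i * pi" using sin_zero_iff_int2 by blast
      then have y: "y = 2 * pi * of_int i" by simp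
      have "y - x = 2 * pi * of_int (i - k)" by (simp add: y k algebra_simps)
      then have "2 * pi * \<bar>of_int (i - k)\<bar> < 2 * pi * 1"
        using elim by (simp add: dist_real_def abs_mult abs_minus_commute[of x])
      then have "\<bar>of_int (i - k) :: real\<bar> < 1" by (subst (asm) mult_less_cancel_left_pos) auto
      then have "i = k" by linarith
      with elim y k show False by simp
    qed
    then show ?case using rr_formula_eq_rr_poly assms by simp
  qed
  moreover have "(rr_poly n \<longlongrightarrow> rr_poly n x) (at x)"
    using continuous_on_rr_poly[of UNIV n] by (simp add: continuous_on_def)
  ultimately have "(rr_formula n \<longlongrightarrow> rr_poly n x) (at x)"
    by (rule Lim_transform_eventually[rotated])
  then have "Lim (at x) (rr_formula n) = rr_poly n x"
    by (intro tendsto_Lim) auto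
  then show ?thesis using True by (simp add: rr_density_def)
next
  case False
  have "sin (x / 2) \<noteq> 0"
  proof
    assume "sin (x / 2) = 0"
    then obtain i :: int where "x / 2 = of_int i * pi" using sin_zero_iff_int2 by blast
    then have "x = 2 * pi * of_int i" by simp
    with False show False by blast
  qed
  then show ?thesis using False rr_formula_eq_rr_poly[OF assms] by (simp add: rr_density_def)
qed

section \<open>Fourier coefficients of the spectral density\<close>

text \<open>\<open>nat\<close> truncates n - |m| at 0, which encodes that indices at distance
  \<open>n\<close> or more never share a block. For n > 1 the value at m = 0 is n/(n-1) - 1/(n-1) =
  1.\<close>

definition rr_autocorrelation :: "nat \<Rightarrow> int \<Rightarrow> real" where
  "rr_autocorrelation n m = real n / (real n - 1) * of_bool (m = 0)
     - real (nat (int n - \<bar>m\<bar>)) / (real n * (real n - 1))"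

lemma has_integral_cos_int:
  "((\<lambda>f. cos (2 * pi * of_int m * f)) has_integral of_bool (m = 0)) {0..1}"
proof (cases "m = 0")
  case True
  then show ?thesis using has_integral_const_real[of "1::real" 0 1] by simp
next
  case False
  have "((\<lambda>f. cos (2 * pi * of_int m * f)) has_integral
      (sin (2 * pi * of_int m * 1) / (2 * pi * of_int m) - sin (2 * pi * of_int m * 0) / (2 * pi * of_int m))) {0..1}"
    using False by (intro fundamental_theorem_of_calculus)
      (auto intro!: derivative_eq_intros simp flip: has_real_derivative_iff_has_vector_derivative)
  moreover have "sin (2 * pi * of_int m * 1) = 0"
    using sin_integer_2pi[of "of_int m"] by simp
  ultimately show ?thesis using False by simp
qed

text \<open>By the product formula each \<open>j\<close> contributes half a unit for j = m and half
  a unit for j = -m, and both values lie in the summation range exactly when |m| <= k. For m = 0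
  both halves come from j = 0.\<close>

lemma has_integral_cos_dirichlet_kernel:
  "((\<lambda>f. cos (2 * pi * of_int m * f) * dirichlet_kernel k (2 * pi * f))
     has_integral of_bool (\<bar>m\<bar> \<le> int k)) {0..1}"
proof -
  have "((\<lambda>f. \<Sum>j\<in>{-int k..int k}. (cos (2 * pi * of_int (m - j) * f) + cos (2 * pi * of_int (m + j) * f)) / 2)
     has_integral (\<Sum>j\<in>{-int k..int k}. (of_bool (m - j = 0) + of_bool (m + j = 0)) / 2)) {0..1}"
    by (intro has_integral_sum has_integral_divide has_integral_add has_integral_cos_int) auto
  moreover have "(\<Sum>j\<in>{-int k..int k}. (cos (2 * pi * of_int (m - j) * f) + cos (2 * pi * of_int (m + j) * f)) / 2)
      = cos (2 * pi * of_int m * f) * dirichlet_kernel k (2 * pi * f)" for f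
    unfolding dirichlet_kernel_def sum_distrib_left
  proof (intro sum.cong refl)
    fix j :: int
    have "2 * pi * of_int (m - j) * f = 2 * pi * of_int m * f - of_int j * (2 * pi * f)"
      "2 * pi * of_int (m + j) * f = 2 * pi * of_int m * f + of_int j * (2 * pi * f)"
      by (simp_all add: algebra_simps)
    then show "(cos (2 * pi * of_int (m - j) * f) + cos (2 * pi * of_int (m + j) * f)) / 2
        = cos (2 * pi * of_int m * f) * cos (of_int j * (2 * pi * f))"
      by (simp only: cos_times_cos)
  qed
  moreover have "(\<Sum>j\<in>{-int k..int k}. (of_bool (m - j = 0) + of_bool (m + j = 0)) / 2) = (of_bool (\<bar>m\<bar> \<le> int k) :: real)"
  proof -
    have "(\<Sum>j\<in>{-int k..int k}. of_bool (m - j = 0)) = (of_bool (\<bar>m\<bar> \<le> int k) :: real)"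
      by (subst sum.cong[OF refl, of _ _ "\<lambda>j. if m = j then 1 else 0"]) auto
    moreover have "(\<Sum>j\<in>{-int k..int k}. of_bool (m + j = 0)) = (of_bool (\<bar>m\<bar> \<le> int k) :: real)"
      by (subst sum.cong[OF refl, of _ _ "\<lambda>j. if - m = j then 1 else 0"]) auto
    ultimately show ?thesis by (simp add: sum_divide_distrib[symmetric] sum.distrib)
  qed
  ultimately show ?thesis by simp
qed

text \<open>The condition |m| <= k holds for max(0, n - |m|) of the indices k < n: the triangular
  coefficients of the Fejer kernel.\<close>

lemma has_integral_cos_rr_poly:
  "((\<lambda>f. cos (2 * pi * of_int m * f) * rr_poly n (2 * pi * f))
     has_integral rr_autocorrelation n m) {0..1}"
proof -
  have "((\<lambda>f. real n / (real n - 1) * cos (2 * pi * of_int m * f)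
        - 1 / (real n * (real n - 1)) * (\<Sum>k<n. cos (2 * pi * of_int m * f) * dirichlet_kernel k (2 * pi * f)))
     has_integral (real n / (real n - 1) * of_bool (m = 0)
        - 1 / (real n * (real n - 1)) * (\<Sum>k<n. of_bool (\<bar>m\<bar> \<le> int k)))) {0..1}"
    by (intro has_integral_diff has_integral_mult_right has_integral_sum
        has_integral_cos_int has_integral_cos_dirichlet_kernel) auto
  moreover have "(\<Sum>k<n. of_bool (\<bar>m\<bar> \<le> int k)) = real (nat (int n - \<bar>m\<bar>))"
  proof -
    have "{..<n} \<inter> {k. \<bar>m\<bar> \<le> int k} = {nat \<bar>m\<bar>..<n}" by auto
    then show ?thesis by (simp add: nat_diff_distrib')
  qed
  ultimately show ?thesis
    by (simp add: rr_poly_def rr_autocorrelation_def sum_distrib_left algebra_simps)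
qed

section \<open>Autocovariance of reshuffled noise\<close>

lemma length_permutation_of_interval:
  assumes "\<sigma> \<in> permutations_of_set {1..n}"
  shows "length \<sigma> = n"
  using length_finite_permutations_of_set[OF assms] by simp

text \<open>Exchangeability: rearranging positions by a fixed permutation is a bijection on the
  arrangements of 1, ..., n, undone by the inverse rearrangement.\<close>

lemma sum_permutations_permute_list:
  assumes "\<pi> permutes {..<n}"
  shows "(\<Sum>\<sigma>\<in>permutations_of_set {1..n}. \<phi> (permute_list \<pi> \<sigma>)) =
         (\<Sum>\<sigma>\<in>permutations_of_set {1..n}. \<phi> \<sigma>)"
proof (rule sum.reindex_bij_witness[where j = "permute_list \<pi>" and i = "permute_list (inv \<pi>)"])
  fix \<sigma> assume \<sigma>: "\<sigma> \<in> permutations_of_set {1..n}"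
  note len = length_permutation_of_interval[OF \<sigma>]
  have inv: "inv \<pi> permutes {..<n}" by (rule permutes_inv[OF assms])
  show "permute_list (inv \<pi>) (permute_list \<pi> \<sigma>) = \<sigma>"
    using permute_list_compose[of "inv \<pi>" \<sigma> \<pi>] inv len permutes_inv_o(1)[OF assms] by simp
  show "permute_list \<pi> (permute_list (inv \<pi>) \<sigma>) = \<sigma>"
    using permute_list_compose[of \<pi> \<sigma> "inv \<pi>"] assms len permutes_inv_o(2)[OF assms] by simp
  show "permute_list \<pi> \<sigma> \<in> permutations_of_set {1..n}"
    "permute_list (inv \<pi>) \<sigma> \<in> permutations_of_set {1..n}"
    using \<sigma> assms inv len by (auto simp: permutations_of_set_def)
qed auto

lemma sum_nth_permutation:
  fixes f :: "nat \<Rightarrow> 'a::comm_monoid_add"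
  assumes "\<sigma> \<in> permutations_of_set {1..n}"
  shows "(\<Sum>p<n. f (\<sigma> ! p)) = (\<Sum>i=1..n. f i)"
proof (rule sum.reindex_bij_betw)
  have "distinct \<sigma>" "set \<sigma> = {1..n}" using assms by (auto simp: permutations_of_set_def)
  then show "bij_betw ((!) \<sigma>) {..<n} {1..n}"
    by (intro bij_betw_nth) (auto simp: length_permutation_of_interval[OF assms])
qed

text \<open>By exchangeability the sum is the same for every position. Summed over all positions,
  each of the n! permutations yields the full sum of \<open>f\<close>.\<close>

lemma sum_permutations_nth:
  fixes f :: "nat \<Rightarrow> real"
  assumes "p < n"
  shows "(\<Sum>\<sigma>\<in>permutations_of_set {1..n}. f (\<sigma> ! p)) = fact n * mean n f"
proof -
  define S where "S = (\<lambda>q. \<Sum>\<sigma>\<in>permutations_of_set {1..n}. f (\<sigma> ! q))"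
  have "S q = S p" if "q < n" for q
  proof -
    have tr: "Transposition.transpose p q permutes {..<n}"
      using assms that by (intro permutes_swap_id) auto
    have "S q = (\<Sum>\<sigma>\<in>permutations_of_set {1..n}. f (permute_list (Transposition.transpose p q) \<sigma> ! p))"
      unfolding S_def using tr assms that
      by (intro sum.cong refl) (subst permute_list_nth, auto simp: length_permutation_of_interval)
    also have "\<dots> = S p"
      unfolding S_def by (rule sum_permutations_permute_list[OF tr])
    finally show ?thesis .
  qed
  then have "real n * S p = (\<Sum>q<n. S q)" by simp
  also have "\<dots> = (\<Sum>\<sigma>\<in>permutations_of_set {1..n}. \<Sum>i=1..n. f i)"
    unfolding S_def by (subst sum.swap) (intro sum.cong refl sum_nth_permutation)
  also have "\<dots> = fact n * (\<Sum>i=1..n. f i)" by simp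
  finally show ?thesis using assms by (simp add: S_def mean_def field_simps)
qed

text \<open>By exchangeability every position other than \<open>p\<close> gives the same sum as
  \<open>q\<close>. Over all positions the products cancel, because \<open>v\<close> sums to zero,
  so the diagonal term is balanced by n - 1 equal off-diagonal ones.\<close>

lemma sum_permutations_nth_mult_nth:
  fixes v :: "nat \<Rightarrow> real"
  assumes "p < n" "q < n" "p \<noteq> q" and v: "mean n v = 0"
  shows "(\<Sum>\<sigma>\<in>permutations_of_set {1..n}. v (\<sigma> ! p) * v (\<sigma> ! q)) =
         - fact n * mean n (\<lambda>i. (v i)\<^sup>2) / (real n - 1)"
proof -
  define S where "S = (\<lambda>r. \<Sum>\<sigma>\<in>permutations_of_set {1..n}. v (\<sigma> ! p) * v (\<sigma> ! r))"
  have "S r = S q" if "r < n" "r \<noteq> p" for r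
  proof -
    \<comment> \<open>Swapping \<open>q\<close> and \<open>r\<close> leaves \<open>p\<close> fixed,
      so only the second factor moves.\<close>
    have tr: "Transposition.transpose q r permutes {..<n}"
      using assms that by (intro permutes_swap_id) auto
    have "S r = (\<Sum>\<sigma>\<in>permutations_of_set {1..n}.
        v (permute_list (Transposition.transpose q r) \<sigma> ! p) * v (permute_list (Transposition.transpose q r) \<sigma> ! q))"
      unfolding S_def using tr assms that
      by (intro sum.cong refl) (simp add: permute_list_nth length_permutation_of_interval)
    also have "\<dots> = S q"
      unfolding S_def by (rule sum_permutations_permute_list[OF tr])
    finally show ?thesis .
  qed
  then have "(\<Sum>r\<in>{..<n} - {p}. S r) = (\<Sum>r\<in>{..<n} - {p}. S q)" by (intro sum.cong) auto
  then have "(\<Sum>r<n. S r) = S p + (real n - 1) * S q"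
    using assms by (subst sum.remove[of _ p]) (auto simp: of_nat_diff)
  moreover have "(\<Sum>r<n. S r) = (\<Sum>\<sigma>\<in>permutations_of_set {1..n}. v (\<sigma> ! p) * (\<Sum>i=1..n. v i))"
    unfolding S_def
    by (subst sum.swap) (intro sum.cong refl, simp add: sum_distrib_left[symmetric] sum_nth_permutation)
  moreover have "(\<Sum>i=1..n. v i) = 0" using v assms by (simp add: mean_def)
  moreover have "S p = fact n * mean n (\<lambda>i. (v i)\<^sup>2)"
    unfolding S_def using sum_permutations_nth[of p n "\<lambda>i. (v i)\<^sup>2"] assms
    by (simp add: power2_eq_square)
  moreover have "real n - 1 > 0" using assms by linarith
  ultimately show ?thesis by (simp add: S_def field_simps eq_neg_iff_add_eq_0)
qed

text \<open>As \<open>t\<close> runs through 0, ..., n-1, the position r = (j - t) mod n of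
  \<open>j\<close> in its block takes each value once. For j <= l both indices share a block iff r +
  (l - j) < n, which leaves max(0, n - (l - j)) positions; the other order follows by
  symmetry.\<close>

lemma card_same_block:
  assumes "n > 0"
  shows "card {t\<in>{..<n}. (j - int t) div int n = (l - int t) div int n} = nat (int n - \<bar>j - l\<bar>)"
proof -
  have *: "card {t\<in>{..<n}. (j - int t) div int n = (l - int t) div int n} = nat (int n - (l - j))"
    if "j \<le> l" for j l :: int
  proof -
    have "bij_betw (\<lambda>t. (j - int t) mod int n)
        {t\<in>{..<n}. (j - int t) div int n = (l - int t) div int n} {0..<int n - (l - j)}"
    proof (rule bij_betw_byWitness[where f' = "\<lambda>r. nat ((j - r) mod int n)"])
      show "\<forall>t\<in>{t\<in>{..<n}. (j - int t) div int n = (l - int t) div int n}.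
          nat ((j - (j - int t) mod int n) mod int n) = t"
        by (auto simp: mod_simps)
      show "\<forall>r\<in>{0..<int n - (l - j)}. (j - int (nat ((j - r) mod int n))) mod int n = r"
        using assms \<open>j \<le> l\<close> by (auto simp: mod_simps)
      \<comment> \<open>Adding l - j to the remainder keeps the quotient exactly when there is no
        carry into the next block.\<close>
      have same: "(j - t) div int n = (l - t) div int n \<longleftrightarrow> (j - t) mod int n + (l - j) < int n" for t
      proof -
        define a r where "a = (j - t) div int n" and "r = (j - t) mod int n"
        have jt: "j - t = a * int n + r" by (simp add: a_def r_def)
        have r: "0 \<le> r" "r < int n" using assms by (auto simp: r_def)
        have "l - t = (r + (l - j)) + a * int n" using jt by simp
        then have "(l - t) div int n = a + (r + (l - j)) div int n"
          using assms by (simp only: div_mult_self1)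
        moreover have "(r + (l - j)) div int n = 0 \<longleftrightarrow> r + (l - j) < int n"
          using r \<open>j \<le> l\<close> assms by (auto simp: zdiv_eq_0_iff)
        ultimately show ?thesis unfolding a_def[symmetric] r_def[symmetric] by auto
      qed
      show "(\<lambda>t. (j - int t) mod int n) ` {t\<in>{..<n}. (j - int t) div int n = (l - int t) div int n}
          \<subseteq> {0..<int n - (l - j)}"
        using assms by (auto simp: same)
      show "(\<lambda>r. nat ((j - r) mod int n)) ` {0..<int n - (l - j)}
          \<subseteq> {t\<in>{..<n}. (j - int t) div int n = (l - int t) div int n}"
        using assms \<open>j \<le> l\<close> by (auto simp: same mod_simps nat_less_iff)
    qed
    then show ?thesis by (simp add: bij_betw_same_card)
  qed
  show ?thesis
  proof (cases "j \<le> l")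
    case True
    then show ?thesis using * by simp
  next
    case False
    then show ?thesis using *[of l j] by (simp add: eq_commute)
  qed
qed

section \<open>Conditioning on the random start\<close>

text \<open>The law of total expectation for \<open>n\<close> equally likely events. Each
  conditional measure has density \<open>n\<close> on its event, and these events cover the space up
  to a null set.\<close>

lemma integral_eq_mean_uniform_measure:
  fixes f :: "'w \<Rightarrow> real"
  assumes rr: "random_reshuffling n M T idx" and "n > 0" and f: "integrable M f"
  shows "(LINT \<omega>|M. f \<omega>) =
    (\<Sum>t<n. LINT \<omega>|uniform_measure M {\<omega> \<in> space M. T \<omega> = t}. f \<omega>) / real n"
proof -
  interpret prob_space M using rr by (simp add: random_reshuffling_def)
  have T [measurable]: "T \<in> measurable M (count_space UNIV)"
    and dT: "distr M (count_space UNIV) T = measure_pmf (pmf_of_set {0..<n})"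
    using rr by (auto simp: random_reshuffling_def)
  define E where "E = (\<lambda>t. {\<omega> \<in> space M. T \<omega> = t})"
  have E [measurable]: "E t \<in> sets M" for t unfolding E_def by measurable
  \<comment> \<open>The law of \<open>T\<close> gives T < n only almost surely, so the indicators
    below sum to one almost everywhere.\<close>
  have "AE \<omega> in distr M (count_space UNIV) T. \<omega> < n"
    unfolding dT AE_measure_pmf_iff using assms by (subst set_pmf_of_set) auto
  then have AE: "AE \<omega> in M. T \<omega> < n" by (subst (asm) AE_distr_iff) auto
  have pE: "emeasure M (E t) = ennreal (1 / real n)" if "t < n" for t
  proof -
    have "T -` {t} \<inter> space M = E t" by (auto simp: E_def)
    then have "emeasure M (E t) = emeasure (measure_pmf (pmf_of_set {0..<n})) {t}"
      by (subst dT[symmetric], subst emeasure_distr) auto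
    also have "\<dots> = ennreal (1 / real n)"
      using that assms by (simp add: emeasure_pmf_single)
    finally show ?thesis .
  qed
  have "(LINT \<omega>|uniform_measure M (E t). f \<omega>) / real n = (LINT \<omega>|M. indicator (E t) \<omega> * f \<omega>)"
    if "t < n" for t
  proof -
    have "1 / ennreal (1 / real n) = ennreal (real n)"
      using \<open>n > 0\<close> divide_ennreal[of 1 "1 / real n"] by simp
    then have "uniform_measure M (E t) = density M (\<lambda>\<omega>. ennreal (real n * indicator (E t) \<omega>))"
      unfolding uniform_measure_def pE[OF that]
      using \<open>n > 0\<close> by (intro arg_cong[of _ _ "density M"] ext)
        (auto simp: indicator_def)
    then have "(LINT \<omega>|uniform_measure M (E t). f \<omega>) =
        (LINT \<omega>|M. (real n * indicator (E t) \<omega>) *\<^sub>R f \<omega>)"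
      using f by (simp only:) (intro integral_density, auto)
    also have "\<dots> = real n * (LINT \<omega>|M. indicator (E t) \<omega> * f \<omega>)"
      by (simp add: mult.assoc)
    finally show ?thesis using \<open>n > 0\<close> by simp
  qed
  then have "(\<Sum>t<n. LINT \<omega>|uniform_measure M (E t). f \<omega>) / real n =
      (\<Sum>t<n. LINT \<omega>|M. indicator (E t) \<omega> * f \<omega>)"
    by (simp add: sum_divide_distrib)
  also have "\<dots> = (LINT \<omega>|M. (\<Sum>t<n. indicator (E t) \<omega> * f \<omega>))"
    using integrable_mult_indicator[OF E f]
    by (intro Bochner_Integration.integral_sum[symmetric]) simp
  also have "\<dots> = (LINT \<omega>|M. f \<omega>)"
  proof (rule integral_cong_AE)
    show "AE \<omega> in M. (\<Sum>t<n. indicator (E t) \<omega> * f \<omega>) = f \<omega>"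
      using AE AE_space
    proof eventually_elim
      case (elim \<omega>)
      have "(\<Sum>t<n. indicator (E t) \<omega> * f \<omega>) = (\<Sum>t<n. if t = T \<omega> then f \<omega> else 0)"
        using elim by (intro sum.cong) (auto simp: E_def indicator_def)
      then show ?case using elim by simp
    qed
  qed (use f in auto)
  finally show ?thesis by (simp add: E_def)
qed

lemma random_reshuffling_idx_range:
  assumes "random_reshuffling n M T idx" "\<omega> \<in> space M"
  shows "idx j \<omega> \<in> {1..n}"
  using assms by (auto simp: random_reshuffling_def dest!: measurable_space)

lemma random_reshuffling_measurable:
  assumes rr: "random_reshuffling n M T idx"
  shows "(\<lambda>\<omega>. v (idx j \<omega>)) \<in> borel_measurable M"
proof -
  have "idx j \<in> measurable M (count_space {1..n})"
    using rr by (simp add: random_reshuffling_def)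
  moreover have "v \<in> borel_measurable (count_space {1..n})" by simp
  ultimately show ?thesis by (rule measurable_compose)
qed

lemma expectation_permutation_block:
  fixes \<phi> :: "nat list \<Rightarrow> real"
  assumes "distr U (count_space UNIV) X = measure_pmf (pmf_of_set (permutations_of_set {1..n}))"
    and "X \<in> measurable U (count_space UNIV)"
  shows "(LINT \<omega>|U. \<phi> (X \<omega>)) = (\<Sum>\<sigma>\<in>permutations_of_set {1..n}. \<phi> \<sigma>) / fact n"
    and "integrable U (\<lambda>\<omega>. \<phi> (X \<omega>))"
proof -
  have "(LINT \<omega>|U. \<phi> (X \<omega>)) = (LINT \<sigma>|distr U (count_space UNIV) X. \<phi> \<sigma>)"
    using assms(2) by (intro integral_distr[symmetric]) auto
  then show "(LINT \<omega>|U. \<phi> (X \<omega>)) = (\<Sum>\<sigma>\<in>permutations_of_set {1..n}. \<phi> \<sigma>) / fact n"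
    unfolding assms(1) by (subst (asm) integral_pmf_of_set) auto
  have "integrable (distr U (count_space UNIV) X) \<phi>"
    unfolding assms(1) by (rule integrable_measure_pmf_finite) simp
  then show "integrable U (\<lambda>\<omega>. \<phi> (X \<omega>))"
    using assms(2) by (subst (asm) integrable_distr_eq) auto
qed

text \<open>The indices take finitely many values, so both factors are bounded. Two separate
  functions are allowed so that w = 1 covers first moments.\<close>

lemma integrable_rr_product:
  fixes v w :: "nat \<Rightarrow> real"
  assumes rr: "random_reshuffling n M T idx"
  shows "integrable M (\<lambda>\<omega>. v (idx j \<omega>) * w (idx l \<omega>))"
proof -
  interpret prob_space M using rr by (simp add: random_reshuffling_def)
  define C where "C = (\<lambda>v :: nat \<Rightarrow> real. Max ((\<lambda>i. \<bar>v i\<bar>) ` {1..n}))"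
  have C: "\<bar>v (idx j \<omega>)\<bar> \<le> C v" if "\<omega> \<in> space M" for v j \<omega>
    unfolding C_def using random_reshuffling_idx_range[OF rr that] by (intro Max_ge) auto
  show ?thesis
  proof (rule integrable_const_bound[where B = "C v * C w"])
    show "AE \<omega> in M. norm (v (idx j \<omega>) * w (idx l \<omega>)) \<le> C v * C w"
      by (auto simp: abs_mult intro!: mult_mono C order_trans[OF abs_ge_zero C])
  qed (intro borel_measurable_times random_reshuffling_measurable[OF rr])
qed

lemma random_reshuffling_conditional:
  assumes rr: "random_reshuffling n M T idx" and t: "t < n"
  defines "U \<equiv> uniform_measure M {\<omega> \<in> space M. T \<omega> = t}"
  shows "prob_space U"
    and "prob_space.indep_vars U (\<lambda>_. count_space UNIV) (block n idx t) UNIV"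
    and "block n idx t m \<in> measurable U (count_space UNIV)"
    and "distr U (count_space UNIV) (block n idx t m) =
      measure_pmf (pmf_of_set (permutations_of_set {1..n}))"
proof -
  interpret M: prob_space M using rr by (simp add: random_reshuffling_def)
  have T [measurable]: "T \<in> measurable M (count_space UNIV)"
    and dT: "distr M (count_space UNIV) T = measure_pmf (pmf_of_set {0..<n})"
    using rr by (auto simp: random_reshuffling_def)
  have "emeasure M {\<omega> \<in> space M. T \<omega> = t} = emeasure (measure_pmf (pmf_of_set {0..<n})) {t}"
    by (subst dT[symmetric], subst emeasure_distr) (auto intro!: arg_cong[of _ _ "emeasure M"])
  also have "\<dots> \<noteq> 0" using t by (simp add: emeasure_pmf_single)
  finally show "prob_space U"
    unfolding U_def by (intro prob_space_uniform_measure) auto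
  then interpret U: prob_space U .
  show ind: "U.indep_vars (\<lambda>_. count_space UNIV) (block n idx t) UNIV"
    and "distr U (count_space UNIV) (block n idx t m) =
      measure_pmf (pmf_of_set (permutations_of_set {1..n}))"
    using rr t unfolding random_reshuffling_def U_def Let_def by auto
  show "block n idx t m \<in> measurable U (count_space UNIV)"
    using ind unfolding U.indep_vars_def by auto
qed

text \<open>Division with remainder of j - t by \<open>n\<close> gives the block number and the
  position in the block. Integer division rounds down, so negative indices are covered as
  well.\<close>

lemma idx_eq_block_nth:
  assumes "n > 0"
  shows "idx j \<omega> = block n idx t ((j - int t) div int n) \<omega> ! nat ((j - int t) mod int n)"
proof -
  have "nat ((j - int t) mod int n) < n" using assms by (simp add: nat_less_iff)
  moreover have "j = int t + int n * ((j - int t) div int n) + int (nat ((j - int t) mod int n))"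
    using assms by (simp add: mult.commute[of "int n"])
  ultimately show ?thesis by (simp add: block_def)
qed

context
  fixes n :: nat and M :: "'w measure" and T :: "'w \<Rightarrow> nat" and idx :: "int \<Rightarrow> 'w \<Rightarrow> nat"
    and v :: "nat \<Rightarrow> real"
  assumes rr: "random_reshuffling n M T idx" and n: "n \<ge> 2" and v0: "mean n v = 0"
begin

text \<open>The correlation \<open>-1/(n-1)\<close> within a block comes from the noise values of a whole block
  summing to zero.\<close>

lemma conditional_covariance_rr_noise:
  assumes t: "t < n"
  shows "(LINT \<omega>|uniform_measure M {\<omega> \<in> space M. T \<omega> = t}. v (idx j \<omega>) * v (idx l \<omega>)) =
    mean n (\<lambda>i. (v i)\<^sup>2) *
      (real n / (real n - 1) * of_bool (j = l)
       - of_bool ((j - int t) div int n = (l - int t) div int n) / (real n - 1))"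
proof -
  define U where "U = uniform_measure M {\<omega> \<in> space M. T \<omega> = t}"
  define s where "s = mean n (\<lambda>i. (v i)\<^sup>2)"
  define B where "B = block n idx t"
  note U = random_reshuffling_conditional[OF rr t, folded U_def B_def]
  interpret U: prob_space U by (rule U(1))
  note ex = expectation_permutation_block[OF U(4) U(3)]
  define pos where "pos = (\<lambda>j. nat ((j - int t) mod int n))"
  define blk where "blk = (\<lambda>j. (j - int t) div int n)"
  have pos: "pos j < n" for j unfolding pos_def using n by (simp add: nat_less_iff)
  have jt: "j = int t + int n * blk j + int (pos j)" for j
    unfolding pos_def blk_def using n by (simp add: mult.commute[of "int n"])
  have idx: "idx j \<omega> = B (blk j) \<omega> ! pos j" for j \<omega>
    using n unfolding B_def blk_def pos_def by (intro idx_eq_block_nth) simp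
  have "(LINT \<omega>|U. v (idx j \<omega>) * v (idx l \<omega>)) =
      s * (real n / (real n - 1) * of_bool (j = l) - of_bool (blk j = blk l) / (real n - 1))"
  proof (cases "blk j = blk l")
    case True
    have "(LINT \<omega>|U. v (idx j \<omega>) * v (idx l \<omega>)) =
        (\<Sum>\<sigma>\<in>permutations_of_set {1..n}. v (\<sigma> ! pos j) * v (\<sigma> ! pos l)) / fact n"
      unfolding idx True by (rule ex(1))
    also have "\<dots> = (if pos j = pos l then s else - s / (real n - 1))"
    proof (cases "pos j = pos l")
      case True
      then show ?thesis
        using sum_permutations_nth[OF pos[of j], of "\<lambda>i. (v i)\<^sup>2"] by (simp add: s_def power2_eq_square)
    next
      case False
      then show ?thesis
        using sum_permutations_nth_mult_nth[OF pos[of j] pos[of l] False v0] by (simp add: s_def)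
    qed
    also have "pos j = pos l \<longleftrightarrow> j = l" using True jt by metis
    finally have "(LINT \<omega>|U. v (idx j \<omega>) * v (idx l \<omega>)) = (if j = l then s else - s / (real n - 1))" .
    moreover have "real n / (real n - 1) - 1 / (real n - 1) = 1"
      using n by (simp add: diff_divide_distrib[symmetric])
    ultimately show ?thesis using True by simp
  next
    case False
    have ne: "j \<noteq> l" using False by auto
    \<comment> \<open>Independence takes one function per block number; the case distinction on
      \<open>m\<close> lets the two blocks be read at different positions.\<close>
    define F where "F = (\<lambda>m \<sigma>. v (\<sigma> ! (if m = blk j then pos j else pos l)))"
    have ind2: "U.indep_vars (\<lambda>_. borel) (\<lambda>m. F m \<circ> B m) {blk j, blk l}"
      by (rule U.indep_vars_compose[OF U.indep_vars_subset[OF U(2)]]) auto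
    have "(LINT \<omega>|U. v (idx j \<omega>) * v (idx l \<omega>)) =
        (LINT \<omega>|U. (\<Prod>m\<in>{blk j, blk l}. (F m \<circ> B m) \<omega>))"
      using False by (simp add: idx F_def)
    also have "\<dots> = (\<Prod>m\<in>{blk j, blk l}. LINT \<omega>|U. (F m \<circ> B m) \<omega>)"
      by (rule U.indep_vars_lebesgue_integral[OF _ ind2]) (auto simp: o_def intro: ex(2))
    also have "(LINT \<omega>|U. (F (blk j) \<circ> B (blk j)) \<omega>) = 0"
      using ex(1)[of "F (blk j)"] sum_permutations_nth[OF pos[of j], of v] v0
      by (simp add: F_def)
    then have "(\<Prod>m\<in>{blk j, blk l}. LINT \<omega>|U. (F m \<circ> B m) \<omega>) = 0"
      using False by simp
    finally show ?thesis using False ne by simp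
  qed
  then show ?thesis by (simp only: U_def s_def blk_def)
qed

text \<open>Averaging the conditional covariances over \<open>t\<close> turns the same-block
  indicator into its frequency, max(0, n - |j - l|) / n, by \<open>card_same_block\<close>. Only the
  difference j - l remains, so the noise is stationary to second order.\<close>

lemma covariance_rr_noise:
  "(LINT \<omega>|M. v (idx j \<omega>) * v (idx l \<omega>)) = mean n (\<lambda>i. (v i)\<^sup>2) * rr_autocorrelation n (j - l)"
proof -
  define s where "s = mean n (\<lambda>i. (v i)\<^sup>2)"
  have "(LINT \<omega>|M. v (idx j \<omega>) * v (idx l \<omega>)) =
      (\<Sum>t<n. s * (real n / (real n - 1) * of_bool (j = l)
        - of_bool ((j - int t) div int n = (l - int t) div int n) / (real n - 1))) / real n"
    using n integrable_rr_product[OF rr, of v j v l]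
    by (subst integral_eq_mean_uniform_measure[OF rr])
      (simp_all add: conditional_covariance_rr_noise s_def)
  also have "(\<Sum>t<n. s * (real n / (real n - 1) * of_bool (j = l)
        - of_bool ((j - int t) div int n = (l - int t) div int n) / (real n - 1))) =
      s * (real n * (real n / (real n - 1) * of_bool (j = l))
        - (\<Sum>t<n. of_bool ((j - int t) div int n = (l - int t) div int n)) / (real n - 1))"
    by (simp add: sum_distrib_left[symmetric] sum_subtractf sum_divide_distrib[symmetric])
  also have "(\<Sum>t<n. of_bool ((j - int t) div int n = (l - int t) div int n)) =
      real (nat (int n - \<bar>j - l\<bar>))"
    using card_same_block[of n j l] n by (simp add: Collect_conj_eq lessThan_def)
  also have "s * (real n * (real n / (real n - 1) * of_bool (j = l))
        - real (nat (int n - \<bar>j - l\<bar>)) / (real n - 1)) / real n = s * rr_autocorrelation n (j - l)"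
  proof -
    have "s * (real n * X - c / (real n - 1)) / real n = s * (X - c / (real n * (real n - 1)))" for X c
      using n by (simp add: right_diff_distrib diff_divide_distrib mult_ac)
    then show ?thesis by (simp only: rr_autocorrelation_def right_minus_eq)
  qed
  finally show ?thesis by (simp add: s_def)
qed

text \<open>A single position of a uniformly random permutation is uniform on 1, ..., n, so each
  conditional expectation is the mean of \<open>v\<close>.\<close>

lemma expectation_rr_noise: "(LINT \<omega>|M. v (idx j \<omega>)) = 0"
proof -
  have "(LINT \<omega>|uniform_measure M {\<omega> \<in> space M. T \<omega> = t}. v (idx j \<omega>)) = 0" if "t < n" for t
  proof -
    note U = random_reshuffling_conditional[OF rr that]
    have "nat ((j - int t) mod int n) < n" using n by (simp add: nat_less_iff)
    from sum_permutations_nth[OF this, of v] show ?thesis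
      using n v0 by (subst idx_eq_block_nth[of n idx j _ t])
        (simp_all add: expectation_permutation_block(1)[OF U(4) U(3), where \<phi> = "\<lambda>\<sigma>. v (\<sigma> ! _)"])
  qed
  then show ?thesis
    using n integrable_rr_product[OF rr, of v j "\<lambda>_. 1" j]
    by (subst integral_eq_mean_uniform_measure[OF rr]) simp_all
qed

end

section \<open>Diagonalising the impulse response\<close>

text \<open>This is \<open>transfer\<close> for a 1 x 1 matrix with entry \<open>l\<close>.\<close>

definition scalar_transfer :: "real \<Rightarrow> real \<Rightarrow> real \<Rightarrow> complex \<Rightarrow> complex" where
  "scalar_transfer \<gamma> \<alpha> l z =
     - of_real \<gamma> * z / (z\<^sup>2 - z * of_real (1 + \<alpha> - \<gamma> * l) + of_real \<alpha>)"

text \<open>The matrix B = (1 + \<alpha>) Id - \<gamma> A is symmetric, so \<open>u\<close> is also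
  a left eigenvector of it, and hence of the invertible matrix \<open>Q\<close> inside
  \<open>transfer\<close>. Multiplying c Q = q c by the inverse of \<open>Q\<close> shows that q is
  nonzero and that the inverse acts on \<open>c\<close> as 1/q.\<close>

lemma transfer_left_eigenvector:
  fixes A :: "real^'d^'d" and u :: "real^'d"
  assumes "pos_def A" "\<gamma> > 0" "0 \<le> \<alpha>" "\<alpha> < 1"
    and B: "pos_semidef (mat (1 + \<alpha>) - \<gamma> *\<^sub>R A)" and z: "cmod z = 1"
    and u: "A *v u = l *\<^sub>R u" "u \<noteq> 0"
  shows "z\<^sup>2 - z * of_real (1 + \<alpha> - \<gamma> * l) + of_real \<alpha> \<noteq> 0"
    and "(\<Sum>i\<in>UNIV. of_real (u $ i) * transfer \<gamma> \<alpha> A z $ i $ j) = scalar_transfer \<gamma> \<alpha> l z * of_real (u $ j)"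
proof -
  define B where "B = mat (1 + \<alpha>) - \<gamma> *\<^sub>R A"
  define Q where "Q = mat (z\<^sup>2) - cscale z (cmatrix B) + mat (of_real \<alpha>)"
  define q where "q = z\<^sup>2 - z * of_real (1 + \<alpha> - \<gamma> * l) + of_real \<alpha>"
  define c where "c = (\<chi> i. complex_of_real (u $ i))"
  have "invertible Q"
    using transfer_invertible[OF assms(1-6)] unfolding Q_def B_def .
  then have QQ: "Q ** matrix_inv Q = mat 1"
    unfolding invertible_def matrix_inv_def by (rule someI2_ex) simp
  have "transpose B = B" using assms(5) by (simp add: B_def pos_semidef_def)
  then have "u v* B = B *v u" using transpose_matrix_vector[of B u] by simp
  also have "mat (1 + \<alpha>) *v u = (1 + \<alpha>) *\<^sub>R u"
    by (simp add: vec_eq_iff matrix_vector_mult_def mat_def if_distrib[of "\<lambda>x. x * _"] cong: if_cong)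
  then have "B *v u = (1 + \<alpha> - \<gamma> * l) *\<^sub>R u"
    unfolding B_def using u(1)
    by (simp add: matrix_vector_mult_diff_rdistrib scaleR_matrix_vector_assoc[symmetric] algebra_simps)
  finally have uB: "u v* B = (1 + \<alpha> - \<gamma> * l) *\<^sub>R u" .
  have cB: "(\<Sum>i\<in>UNIV. of_real (B $ i $ j) * c $ i) = of_real (1 + \<alpha> - \<gamma> * l) * c $ j" for j
  proof -
    have "(\<Sum>i\<in>UNIV. B $ i $ j * u $ i) = (1 + \<alpha> - \<gamma> * l) * u $ j"
      using arg_cong[OF uB, of "\<lambda>v. v $ j"] by (simp add: vector_matrix_mult_def mult.commute)
    from arg_cong[OF this, of complex_of_real] show ?thesis by (simp add: c_def)
  qed
  have cQ: "c v* Q = q *s c"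
  proof (intro vec_eq_iff[THEN iffD2] allI)
    fix j
    have "(c v* Q) $ j = (\<Sum>i\<in>UNIV. (if i = j then z\<^sup>2 + of_real \<alpha> else 0) * c $ i - z * (of_real (B $ i $ j) * c $ i))"
      by (auto simp: vector_matrix_mult_def Q_def mat_def algebra_simps intro!: sum.cong)
    also have "\<dots> = (z\<^sup>2 + of_real \<alpha>) * c $ j - z * (of_real (1 + \<alpha> - \<gamma> * l) * c $ j)"
      by (simp add: sum_subtractf sum_distrib_left[symmetric] cB if_distrib[of "\<lambda>x. x * _"] cong: if_cong)
    also have "\<dots> = (q *s c) $ j" by (simp add: q_def algebra_simps)
    finally show "(c v* Q) $ j = (q *s c) $ j" .
  qed
  have "c = (c v* Q) v* matrix_inv Q"
    by (simp add: vector_matrix_mul_assoc QQ)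
  also have "\<dots> = q *s (c v* matrix_inv Q)"
    unfolding cQ by (simp add: vec_eq_iff vector_matrix_mult_def sum_distrib_left mult_ac)
  finally have cq: "c = q *s (c v* matrix_inv Q)" .
  have "c \<noteq> 0" using u(2) by (auto simp: c_def vec_eq_iff)
  then have "q \<noteq> 0" using cq by auto
  then show "z\<^sup>2 - z * of_real (1 + \<alpha> - \<gamma> * l) + of_real \<alpha> \<noteq> 0" by (simp add: q_def)
  have "(\<Sum>i\<in>UNIV. of_real (u $ i) * transfer \<gamma> \<alpha> A z $ i $ j) = - of_real \<gamma> * z * (c v* matrix_inv Q) $ j"
    by (simp add: transfer_def c_def Q_def B_def vector_matrix_mult_def sum_distrib_left mult_ac)
  also have "\<dots> = - of_real \<gamma> * z / q * c $ j"
    using arg_cong[OF cq, of "\<lambda>v. v $ j"] \<open>q \<noteq> 0\<close> by (simp add: field_simps)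
  finally show "(\<Sum>i\<in>UNIV. of_real (u $ i) * transfer \<gamma> \<alpha> A z $ i $ j) = scalar_transfer \<gamma> \<alpha> l z * of_real (u $ j)"
    by (simp add: scalar_transfer_def q_def c_def)
qed

text \<open>The row vectors u H_k have the Fourier series g(z) u with g =
  \<open>scalar_transfer\<close>. Pairing with the unit vector \<open>u\<close> shows that the
  series of \<open>h\<close> is g. So u H_k and h(k) u have the same series, and
  \<open>fourier_zero\<close> makes them equal.\<close>

lemma impulse_response_eigenvector:
  fixes A :: "real^'d^'d" and u :: "real^'d"
  assumes "pos_def A" "\<gamma> > 0" "0 \<le> \<alpha>" "\<alpha> < 1"
    and "pos_semidef (mat (1 + \<alpha>) - \<gamma> *\<^sub>R A)" and H: "impulse_response \<gamma> \<alpha> A H"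
    and u: "A *v u = l *\<^sub>R u" "u \<bullet> u = 1"
  defines "h \<equiv> \<lambda>k. u \<bullet> (H k *v u)"
  shows "u \<bullet> (H k *v y) = h k * (u \<bullet> y)"
    and "cmod z = 1 \<Longrightarrow> ((\<lambda>k. z powi (- k) * of_real (h k)) has_sum scalar_transfer \<gamma> \<alpha> l z) UNIV"
proof -
  have u0: "u \<noteq> 0" using u(2) by auto
  have row: "((\<lambda>k. z powi (-k) * of_real ((u v* H k) $ j)) has_sum scalar_transfer \<gamma> \<alpha> l z * of_real (u $ j)) UNIV"
    if z: "cmod z = 1" for z j
  proof -
    have "((\<lambda>k. \<Sum>i\<in>UNIV. of_real (u $ i) * (z powi (-k) * of_real (H k $ i $ j)))
        has_sum (\<Sum>i\<in>UNIV. of_real (u $ i) * transfer \<gamma> \<alpha> A z $ i $ j)) UNIV"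
      by (rule has_sum_sum') (auto intro!: has_sum_cmult_right impulse_response_entry[OF H z])
    then show ?thesis
      unfolding transfer_left_eigenvector(2)[OF assms(1-5) z u(1) u0]
      by (simp add: vector_matrix_mult_def sum_distrib_left mult_ac)
  qed
  have h: "u \<bullet> (H k *v y) = (u v* H k) \<bullet> y" for k y by (simp add: dot_lmul_matrix)
  show hs: "((\<lambda>k. z powi (- k) * of_real (h k)) has_sum scalar_transfer \<gamma> \<alpha> l z) UNIV"
    if z: "cmod z = 1" for z
  proof -
    have "((\<lambda>k. \<Sum>j\<in>UNIV. of_real (u $ j) * (z powi (-k) * of_real ((u v* H k) $ j)))
        has_sum (\<Sum>j\<in>UNIV. of_real (u $ j) * (scalar_transfer \<gamma> \<alpha> l z * of_real (u $ j)))) UNIV"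
      by (rule has_sum_sum') (auto intro!: has_sum_cmult_right row z)
    moreover have "(\<Sum>j\<in>UNIV. of_real (u $ j) * (scalar_transfer \<gamma> \<alpha> l z * of_real (u $ j)))
        = scalar_transfer \<gamma> \<alpha> l z * of_real (u \<bullet> u)"
      by (simp add: inner_vec_def sum_distrib_left mult_ac)
    moreover have "(\<Sum>j\<in>UNIV. of_real (u $ j) * (z powi (-k) * of_real ((u v* H k) $ j)))
        = z powi (-k) * complex_of_real (h k)" for k
      unfolding h_def h by (simp add: inner_vec_def sum_distrib_left mult_ac)
    ultimately show ?thesis by (simp add: u(2))
  qed
  have "u v* H k = h k *\<^sub>R u"
  proof (intro vec_eq_iff[THEN iffD2] allI)
    fix j
    have "complex_of_real ((u v* H k) $ j - h k * u $ j) = 0"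
    proof (rule fourier_zero[where a = "\<lambda>k. complex_of_real ((u v* H k) $ j - h k * u $ j)"])
      fix z :: complex assume z: "cmod z = 1"
      have "((\<lambda>k. z powi (-k) * of_real ((u v* H k) $ j) + - of_real (u $ j) * (z powi (- k) * of_real (h k)))
        has_sum (scalar_transfer \<gamma> \<alpha> l z * of_real (u $ j) + - of_real (u $ j) * scalar_transfer \<gamma> \<alpha> l z)) UNIV"
        by (intro has_sum_add has_sum_cmult_right row hs z)
      then show "((\<lambda>k. z powi (-k) * complex_of_real ((u v* H k) $ j - h k * u $ j)) has_sum 0) UNIV"
        by (simp add: algebra_simps)
    qed
    then show "(u v* H k) $ j = (h k *\<^sub>R u) $ j"
      by (simp only: of_real_eq_0_iff) simp
  qed
  then show "u \<bullet> (H k *v y) = h k * (u \<bullet> y)" by (simp add: h)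
qed

section \<open>Variance of the filtered noise\<close>

text \<open>Symmetric intervals eventually contain every finite set. This replaces the net of finite
  partial sums by a sequence, the form that dominated convergence uses.\<close>

lemma has_sum_int_LIMSEQ:
  fixes f :: "int \<Rightarrow> 'a::{comm_monoid_add, topological_space}"
  assumes "(f has_sum s) UNIV"
  shows "(\<lambda>N. \<Sum>j\<in>{- int N..int N}. f j) \<longlonglongrightarrow> s"
proof -
  have "filterlim (\<lambda>N. {- int N..int N}) (finite_subsets_at_top UNIV) sequentially"
    unfolding filterlim_finite_subsets_at_top
  proof (intro allI impI)
    fix X :: "int set" assume X: "finite X \<and> X \<subseteq> UNIV"
    define b where "b = nat (Max (insert 0 (abs ` X)))"
    have "X \<subseteq> {- int N..int N}" if "N \<ge> b" for N
    proof
      fix j assume "j \<in> X"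
      then have "\<bar>j\<bar> \<le> Max (insert 0 (abs ` X))" using X by (intro Max_ge) auto
      then show "j \<in> {- int N..int N}" using that unfolding b_def by auto
    qed
    then show "\<forall>\<^sub>F N in sequentially. finite {- int N..int N} \<and> X \<subseteq> {- int N..int N} \<and> {- int N..int N} \<subseteq> UNIV"
      unfolding eventually_sequentially by auto
  qed
  with assms show ?thesis unfolding has_sum_def by (rule filterlim_compose)
qed

text \<open>Expanding the squared modulus leaves the cosines of phase differences, in which the
  shift by \<open>k\<close> cancels; each is then integrated against \<open>rr_poly\<close>.\<close>

lemma has_integral_norm_square_times_rr_poly:
  assumes "finite F"
  shows "((\<lambda>f. (cmod (\<Sum>j\<in>F. cis (2 * pi * f) powi (- (k - j)) * of_real (a j)))\<^sup>2 * rr_poly n (2 * pi * f))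
    has_integral (\<Sum>j\<in>F. \<Sum>l\<in>F. a j * a l * rr_autocorrelation n (j - l))) {0..1}"
proof -
  have "((\<lambda>f. \<Sum>j\<in>F. \<Sum>l\<in>F. a j * a l * (cos (2 * pi * of_int (j - l) * f) * rr_poly n (2 * pi * f)))
    has_integral (\<Sum>j\<in>F. \<Sum>l\<in>F. a j * a l * rr_autocorrelation n (j - l))) {0..1}"
    by (intro has_integral_sum has_integral_mult_right has_integral_cos_rr_poly assms)
  moreover have "(\<Sum>j\<in>F. \<Sum>l\<in>F. a j * a l * (cos (2 * pi * of_int (j - l) * f) * rr_poly n (2 * pi * f)))
    = (cmod (\<Sum>j\<in>F. cis (2 * pi * f) powi (- (k - j)) * of_real (a j)))\<^sup>2 * rr_poly n (2 * pi * f)" for f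
  proof -
    define \<theta> where "\<theta> = (\<lambda>j. 2 * pi * f * of_int (j - k))"
    have "cis (2 * pi * f) powi (- (k - j)) = cis (\<theta> j)" for j
      by (simp add: cis_power_int \<theta>_def algebra_simps)
    then have "(cmod (\<Sum>j\<in>F. cis (2 * pi * f) powi (- (k - j)) * of_real (a j)))\<^sup>2
        = (\<Sum>j\<in>F. cos (\<theta> j) * a j)\<^sup>2 + (\<Sum>j\<in>F. sin (\<theta> j) * a j)\<^sup>2"
      by (simp add: cmod_power2)
    also have "\<dots> = (\<Sum>j\<in>F. \<Sum>l\<in>F. a j * a l * cos (\<theta> j - \<theta> l))"
      by (simp add: power2_eq_square sum_product sum.distrib[symmetric] cos_diff algebra_simps)
    also have "\<dots> = (\<Sum>j\<in>F. \<Sum>l\<in>F. a j * a l * cos (2 * pi * of_int (j - l) * f))"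
    proof -
      have "\<theta> j - \<theta> l = 2 * pi * of_int (j - l) * f" for j l
        by (simp add: \<theta>_def algebra_simps)
      then show ?thesis by simp
    qed
    finally show ?thesis by (simp only: sum_distrib_right mult.assoc)
  qed
  ultimately show ?thesis by simp
qed

text \<open>For the truncated filter the second moment and the frequency integral are the same
  finite double sum, up to the noise variance. Both sides converge by dominated convergence as the
  truncation is lifted, so the limits agree.\<close>

lemma filtered_rr_noise:
  fixes v :: "nat \<Rightarrow> real" and h :: "int \<Rightarrow> real" and g :: "complex \<Rightarrow> complex"
  assumes rr: "random_reshuffling n M T idx" and n: "n \<ge> 2" and v0: "mean n v = 0"
    and g: "\<And>z. cmod z = 1 \<Longrightarrow> ((\<lambda>k. z powi (- k) * of_real (h k)) has_sum g z) UNIV"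
    and X: "\<And>\<omega>. \<omega> \<in> space M \<Longrightarrow> ((\<lambda>j. h (k - j) * v (idx j \<omega>)) has_sum X \<omega>) UNIV"
  shows "X \<in> borel_measurable M"
    and "\<exists>C. \<forall>\<omega>\<in>space M. \<bar>X \<omega>\<bar> \<le> C"
    and "(LINT \<omega>|M. X \<omega>) = 0"
    and "(LINT \<omega>|M. X \<omega> * X \<omega>) = mean n (\<lambda>i. (v i)\<^sup>2) *
      integral {0..1} (\<lambda>f. (cmod (g (cis (2 * pi * f))))\<^sup>2 * rr_poly n (2 * pi * f))"
proof -
  interpret prob_space M using rr by (simp add: random_reshuffling_def)
  define a where "a = (\<lambda>j. h (k - j))"
  define F where "F = (\<lambda>N. {- int N..int N})"
  define XN where "XN = (\<lambda>N \<omega>. \<Sum>j\<in>F N. a j * v (idx j \<omega>))"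
  define S where "S = (\<Sum>\<^sub>\<infinity>j. \<bar>a j\<bar>)"
  define C where "C = Max ((\<lambda>i. \<bar>v i\<bar>) ` {1..n})"
  have C: "\<bar>v (idx j \<omega>)\<bar> \<le> C" if "\<omega> \<in> space M" for j \<omega>
    unfolding C_def using random_reshuffling_idx_range[OF rr that] by (intro Max_ge) auto
  have fin: "finite (F N)" for N by (simp add: F_def)
  have ga: "((\<lambda>j. z powi (- (k - j)) * of_real (a j)) has_sum g z) UNIV" if "cmod z = 1" for z
    unfolding a_def
    by (subst has_sum_reindex_bij_witness[where j = "\<lambda>j. k - j" and i = "\<lambda>j. k - j" and T = UNIV
          and h = "\<lambda>j. z powi (- j) * of_real (h j)" and s' = "g z"]) (use g[OF that] in auto)
  \<comment> \<open>At z = 1 the series of \<open>g\<close> is the plain sum of the filter, and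
    unordered summability of complex numbers is absolute.\<close>
  have asum: "(\<lambda>j. \<bar>a j\<bar>) summable_on UNIV"
  proof -
    have "(\<lambda>j. complex_of_real (a j)) summable_on UNIV"
      using ga[of 1] by (auto simp: summable_on_def)
    then show ?thesis by (simp add: summable_on_iff_abs_summable_on_complex)
  qed
  have absS: "(\<Sum>j\<in>F N. \<bar>a j\<bar>) \<le> S" for N
    unfolding S_def using asum fin by (intro finite_sum_le_infsum) auto
  have XN_meas [measurable]: "XN N \<in> borel_measurable M" for N
    unfolding XN_def
    by (intro borel_measurable_sum borel_measurable_times borel_measurable_const
        random_reshuffling_measurable[OF rr])
  have lim: "(\<lambda>N. XN N \<omega>) \<longlonglongrightarrow> X \<omega>" if "\<omega> \<in> space M" for \<omega>
    unfolding XN_def F_def a_def by (rule has_sum_int_LIMSEQ[OF X[OF that]])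
  have XN_bound: "\<bar>XN N \<omega>\<bar> \<le> S * C" if "\<omega> \<in> space M" for N \<omega>
  proof -
    have "\<bar>XN N \<omega>\<bar> \<le> (\<Sum>j\<in>F N. \<bar>a j\<bar> * C)"
      unfolding XN_def using C[OF that]
      by (intro order_trans[OF sum_abs] sum_mono) (auto simp: abs_mult intro: mult_left_mono)
    also have "\<dots> \<le> S * C"
      using absS[of N] order_trans[OF abs_ge_zero C[OF that]]
      by (auto simp: sum_distrib_right[symmetric] intro: mult_right_mono)
    finally show ?thesis .
  qed
  show meas [measurable]: "X \<in> borel_measurable M"
    by (rule borel_measurable_LIMSEQ_real[OF lim XN_meas])
  have "\<bar>X \<omega>\<bar> \<le> S * C" if "\<omega> \<in> space M" for \<omega>
    by (rule LIMSEQ_le_const2[OF tendsto_rabs[OF lim[OF that]]]) (use XN_bound[OF that] in auto)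
  then show "\<exists>C. \<forall>\<omega>\<in>space M. \<bar>X \<omega>\<bar> \<le> C" by blast
  have "(\<lambda>N. LINT \<omega>|M. XN N \<omega>) \<longlonglongrightarrow> (LINT \<omega>|M. X \<omega>)"
    by (rule integral_dominated_convergence[where w = "\<lambda>_. S * C"])
       (auto intro!: AE_I2 lim XN_bound)
  \<comment> \<open>Integrability of a single noise value is the product lemma with second factor
    1.\<close>
  moreover have "(LINT \<omega>|M. XN N \<omega>) = 0" for N
    unfolding XN_def using integrable_rr_product[OF rr, of v _ "\<lambda>_. 1"] expectation_rr_noise[OF rr n v0]
    by (subst Bochner_Integration.integral_sum) simp_all
  ultimately show "(LINT \<omega>|M. X \<omega>) = 0" by (simp add: LIMSEQ_const_iff)
  define s where "s = mean n (\<lambda>i. (v i)\<^sup>2)"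
  define gN where "gN = (\<lambda>N f. \<Sum>j\<in>F N. cis (2 * pi * f) powi (- (k - j)) * of_real (a j))"
  have XN2: "(LINT \<omega>|M. XN N \<omega> * XN N \<omega>) =
      s * integral {0..1} (\<lambda>f. (cmod (gN N f))\<^sup>2 * rr_poly n (2 * pi * f))" for N
  proof -
    have "XN N \<omega> * XN N \<omega> = (\<Sum>j\<in>F N. \<Sum>l\<in>F N. a j * a l * (v (idx j \<omega>) * v (idx l \<omega>)))" for \<omega>
      unfolding XN_def sum_product by (simp add: mult_ac)
    then have "(LINT \<omega>|M. XN N \<omega> * XN N \<omega>) =
        (\<Sum>j\<in>F N. \<Sum>l\<in>F N. a j * a l * (LINT \<omega>|M. v (idx j \<omega>) * v (idx l \<omega>)))"
      by (simp add: Bochner_Integration.integral_sum Bochner_Integration.integrable_sum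
          integrable_rr_product[OF rr])
    also have "\<dots> = s * (\<Sum>j\<in>F N. \<Sum>l\<in>F N. a j * a l * rr_autocorrelation n (j - l))"
      by (simp add: covariance_rr_noise[OF rr n v0] s_def sum_distrib_left mult_ac)
    finally show ?thesis
      by (simp only: gN_def integral_unique[OF has_integral_norm_square_times_rr_poly[OF fin]])
  qed
  have "(\<lambda>N. LINT \<omega>|M. XN N \<omega> * XN N \<omega>) \<longlonglongrightarrow> (LINT \<omega>|M. X \<omega> * X \<omega>)"
  proof (rule integral_dominated_convergence[where w = "\<lambda>_. (S * C) * (S * C)"])
    show "AE \<omega> in M. norm (XN N \<omega> * XN N \<omega>) \<le> (S * C) * (S * C)" for N
      unfolding real_norm_def abs_mult
      by (intro AE_I2 mult_mono XN_bound order_trans[OF abs_ge_zero XN_bound] abs_ge_zero)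
  qed (auto intro!: AE_I2 tendsto_mult lim)
  moreover have "(\<lambda>N. integral {0..1} (\<lambda>f. (cmod (gN N f))\<^sup>2 * rr_poly n (2 * pi * f)))
      \<longlonglongrightarrow> integral {0..1} (\<lambda>f. (cmod (g (cis (2 * pi * f))))\<^sup>2 * rr_poly n (2 * pi * f))"
  \<comment> \<open>All phases have modulus 1, so every truncated transfer function is bounded by
    the absolute filter sum \<open>S\<close>. The absolute value makes the bound independent of the
    sign of \<open>rr_poly\<close>.\<close>
  proof (rule dominated_convergence(2)[where h = "\<lambda>f. S\<^sup>2 * \<bar>rr_poly n (2 * pi * f)\<bar>"])
    show "(\<lambda>f. (cmod (gN N f))\<^sup>2 * rr_poly n (2 * pi * f)) integrable_on {0..1}" for N
      unfolding gN_def using has_integral_norm_square_times_rr_poly[OF fin] by blast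
    show "(\<lambda>f. S\<^sup>2 * \<bar>rr_poly n (2 * pi * f)\<bar>) integrable_on {0..1}"
      by (intro integrable_continuous_real continuous_intros
          continuous_on_compose2[OF continuous_on_rr_poly[of UNIV]]) auto
    show "norm ((cmod (gN N f))\<^sup>2 * rr_poly n (2 * pi * f)) \<le> S\<^sup>2 * \<bar>rr_poly n (2 * pi * f)\<bar>" for N f
    proof -
      have "cmod (gN N f) \<le> (\<Sum>j\<in>F N. \<bar>a j\<bar>)"
        unfolding gN_def by (rule order_trans[OF norm_sum]) (simp add: norm_mult norm_power_int)
      also have "\<dots> \<le> S" by (rule absS)
      finally show ?thesis by (auto simp: abs_mult intro!: mult_right_mono power_mono)
    qed
    show "(\<lambda>N. (cmod (gN N f))\<^sup>2 * rr_poly n (2 * pi * f))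
        \<longlonglongrightarrow> (cmod (g (cis (2 * pi * f))))\<^sup>2 * rr_poly n (2 * pi * f)" for f
      unfolding gN_def F_def
      by (intro tendsto_mult tendsto_power tendsto_norm tendsto_const has_sum_int_LIMSEQ ga) simp
  qed
  then have "(\<lambda>N. LINT \<omega>|M. XN N \<omega> * XN N \<omega>)
      \<longlonglongrightarrow> s * integral {0..1} (\<lambda>f. (cmod (g (cis (2 * pi * f))))\<^sup>2 * rr_poly n (2 * pi * f))"
    unfolding XN2 by (rule tendsto_mult_left)
  ultimately show "(LINT \<omega>|M. X \<omega> * X \<omega>) = mean n (\<lambda>i. (v i)\<^sup>2) *
      integral {0..1} (\<lambda>f. (cmod (g (cis (2 * pi * f))))\<^sup>2 * rr_poly n (2 * pi * f))"
    unfolding s_def by (rule LIMSEQ_unique)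
qed

section \<open>From vectors to coordinates\<close>

text \<open>An infinite sum without summability is 0 by convention, so this is what makes the series
  defining the iterates a genuine limit. The filter is absolutely summable and the noise takes
  finitely many values.\<close>

lemma filtered_noise_summable:
  fixes A :: "nat \<Rightarrow> real^'d^'d"
  assumes rr: "random_reshuffling n M T idx" and H: "impulse_response \<gamma> \<alpha> B H"
    and \<omega>: "\<omega> \<in> space M"
  shows "(\<lambda>j. H (k - j) *v noise n A b (idx j \<omega>)) summable_on UNIV"
proof -
  define C where "C = Max ((\<lambda>i. norm (noise n A b i)) ` {1..n})"
  have C: "norm (noise n A b (idx j \<omega>)) \<le> C" for j
    unfolding C_def using random_reshuffling_idx_range[OF rr \<omega>] by (intro Max_ge) auto
  define K where "K = real CARD('d) * real CARD('d)"
  have "(\<lambda>j. norm (H (k - j))) summable_on UNIV"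
    using impulse_response_summable[OF H]
    by (subst summable_on_reindex_bij_witness[where j = "\<lambda>j. k - j" and i = "\<lambda>j. k - j" and T = UNIV
          and h = "\<lambda>j. norm (H j)"]) auto
  then have "(\<lambda>j. K * norm (H (k - j)) * C) summable_on UNIV"
    by (intro summable_on_cmult_left summable_on_cmult_right)
  moreover have "norm (H (k - j) *v noise n A b (idx j \<omega>)) \<le> K * norm (H (k - j)) * C" for j
    by (rule order_trans[OF norm_matrix_vector_le]) (auto simp: K_def intro: mult_left_mono C)
  ultimately have "(\<lambda>j. norm (H (k - j) *v noise n A b (idx j \<omega>))) summable_on UNIV"
    by (rule summable_on_comparison_test) auto
  then show ?thesis by (rule abs_summable_summable)
qed

text \<open>Positive definiteness gives a trivial kernel, hence an invertible mean matrix. With w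
  the solution of A w = b for the means, averaging b_i - A_i w gives b - A w = 0.\<close>

lemma mean_noise:
  fixes A :: "nat \<Rightarrow> real^'d^'d"
  assumes "pos_def (mean n A)"
  shows "mean n (noise n A b) = 0"
proof -
  define w where "w = matrix_inv (mean n A) *v mean n b"
  have "v = 0" if "mean n A *v v = 0" for v
    using assms that unfolding pos_def_def by force
  then have "\<exists>R. R ** mean n A = mat 1"
    unfolding matrix_left_invertible_ker by blast
  then have "invertible (mean n A)"
    by (simp only: invertible_left_inverse)
  then have "mean n A ** matrix_inv (mean n A) = mat 1"
    unfolding invertible_def matrix_inv_def by (rule someI2_ex) simp
  then have "mean n A *v w = mean n b"
    by (simp add: w_def matrix_vector_mul_assoc)
  moreover have "mean n A *v w = mean n (\<lambda>i. A i *v w)"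
  proof -
    have lin: "linear (\<lambda>X :: real^'d^'d. X *v w)"
      by (intro linearI) (simp_all add: matrix_vector_mult_add_rdistrib scaleR_matrix_vector_assoc)
    show ?thesis by (simp add: mean_def linear_sum[OF lin] linear_scale[OF lin])
  qed
  moreover have "noise n A b = (\<lambda>i. b i - A i *v w)"
    by (simp add: noise_def w_def fun_eq_iff)
  then have "mean n (noise n A b) = mean n b - mean n (\<lambda>i. A i *v w)"
    by (simp only: mean_def sum_subtractf scaleR_diff_right)
  ultimately show ?thesis by simp
qed

text \<open>Identifies the variance of the scalar noise along \<open>u\<close> with the weight in
  the final formula.\<close>

lemma quadratic_form_noise_cov:
  fixes u :: "real^'d"
  shows
  "u \<bullet> (noise_cov n A b *v u) = mean n (\<lambda>i. (u \<bullet> noise n A b i)\<^sup>2)"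
proof -
  have lin: "linear (\<lambda>X :: real^'d^'d. u \<bullet> (X *v u))"
    by (intro linearI)
      (simp_all add: matrix_vector_mult_add_rdistrib scaleR_matrix_vector_assoc[symmetric] inner_add_right)
  have "outer v v *v u = (u \<bullet> v) *\<^sub>R v" for v
    by (simp add: vec_eq_iff matrix_vector_mult_def outer_def inner_vec_def sum_distrib_left mult_ac)
  then have "u \<bullet> (outer v v *v u) = (u \<bullet> v)\<^sup>2" for v by (simp add: power2_eq_square)
  then show ?thesis
    by (simp add: noise_cov_def mean_def linear_sum[OF lin] linear_scale[OF lin])
qed

text \<open>The family is indexed by the coordinates themselves, so the matrix \<open>P\<close> with
  these rows is square, and a right inverse is also a left inverse.\<close>

lemma orthonormal_family_expansion:
  fixes u :: "'d::finite \<Rightarrow> real^'d"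
  assumes "\<forall>i j. u i \<bullet> u j = (if i = j then 1 else 0)"
  shows "v = (\<Sum>i\<in>UNIV. (u i \<bullet> v) *\<^sub>R u i)"
proof -
  define P where "P = (\<chi> i. u i)"
  have "P ** transpose P = mat 1"
    using assms by (simp add: vec_eq_iff P_def matrix_matrix_mult_def transpose_def mat_def inner_vec_def)
  then have "transpose P ** P = mat 1" by (simp add: matrix_left_right_inverse)
  then have "v = transpose P *v (P *v v)" by (simp add: matrix_vector_mul_assoc)
  also have "\<dots> = (\<Sum>i\<in>UNIV. (u i \<bullet> v) *\<^sub>R u i)"
    by (simp add: vec_eq_iff P_def matrix_vector_mult_def transpose_def inner_vec_def sum_component mult.commute)
  finally show ?thesis .
qed

lemma trace_outer: "trace (outer v w) = v \<bullet> w"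
  by (simp add: trace_def outer_def inner_vec_def)

lemma bounded_linear_trace: "bounded_linear (trace :: real^'d^'d \<Rightarrow> real)"
  unfolding trace_def
  by (intro bounded_linear_sum bounded_linear_compose[OF bounded_linear_vec_nth bounded_linear_vec_nth])

text \<open>The exponentials on the right are powers of the conjugate of z. The coefficients are
  real, so the two denominators are conjugate and have equal modulus.\<close>

lemma norm_scalar_transfer_cis:
  assumes "\<gamma> > 0"
  shows "(cmod (scalar_transfer \<gamma> \<alpha> l (cis (2 * pi * f))))\<^sup>2 =
    \<gamma>\<^sup>2 * cmod (exp (- 4 * of_real pi * \<i> * of_real f)
             - exp (- 2 * of_real pi * \<i> * of_real f) * of_real (1 + \<alpha> - \<gamma> * l)
             + of_real \<alpha>) powi (-2)"
proof -
  define z where "z = cis (2 * pi * f)"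
  have e2: "exp (- 2 * of_real pi * \<i> * of_real f) = cnj z"
  proof -
    have "cnj z = cis (- (2 * pi * f))" by (simp add: z_def cis_cnj)
    then show ?thesis by (simp add: cis_conv_exp mult_ac)
  qed
  have "exp (- 4 * of_real pi * \<i> * of_real f) = (exp (- 2 * of_real pi * \<i> * of_real f))\<^sup>2"
    unfolding exp_double[symmetric] by (intro arg_cong[of _ _ exp]) simp
  then have "exp (- 4 * of_real pi * \<i> * of_real f)
             - exp (- 2 * of_real pi * \<i> * of_real f) * of_real (1 + \<alpha> - \<gamma> * l) + of_real \<alpha>
      = cnj (z\<^sup>2 - z * of_real (1 + \<alpha> - \<gamma> * l) + of_real \<alpha>)"
    unfolding e2 by simp
  moreover have "cmod z = 1" by (simp add: z_def)
  ultimately show ?thesis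
    unfolding z_def[symmetric] scalar_transfer_def complex_mod_cnj
    by (simp only: complex_mod_cnj norm_divide norm_mult norm_minus_cancel norm_of_real)
       (simp add: power_int_minus power_mult_distrib power_inverse divide_inverse)
qed

section \<open>Assembling the coordinate variances into the trace\<close>

theorem mainTheorem7:
  fixes n :: nat
    and A :: "nat \<Rightarrow> real^'d^'d"
    and b :: "nat \<Rightarrow> real^'d"
    and u :: "'d \<Rightarrow> real^'d"
    and lam :: "'d \<Rightarrow> real"
    and \<gamma> \<alpha> :: real
    and M :: "'w measure"
    and T :: "'w \<Rightarrow> nat"
    and idx :: "int \<Rightarrow> 'w \<Rightarrow> nat"
    and x :: "int \<Rightarrow> 'w \<Rightarrow> real^'d"
    and k :: int
  assumes "n \<ge> 2"
    and "\<forall>i\<in>{1..n}. transpose (A i) = A i"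
    and "pos_def (mean n A)"
    and "\<forall>i j. u i \<bullet> u j = (if i = j then 1 else 0)"
    and "\<forall>i. mean n A *v u i = lam i *\<^sub>R u i"
    and "\<forall>i. lam i > 0"
    and "\<gamma> > 0"
    and "0 \<le> \<alpha>" and "\<alpha> < 1"
    and "pos_semidef (mat (1 + \<alpha>) - \<gamma> *\<^sub>R mean n A)"
    and "random_reshuffling n M T idx"
    and "stationary_sgdm n A b \<gamma> \<alpha> M idx x"
  shows "trace (covariance_matrix M (x k)) =
    \<gamma>\<^sup>2 * (\<Sum>i\<in>UNIV. (u i \<bullet> (noise_cov n A b *v u i)) *
      integral {0..1} (\<lambda>f.
        (cmod (exp (- 4 * of_real pi * \<i> * of_real f)
             - exp (- 2 * of_real pi * \<i> * of_real f) * of_real (1 + \<alpha> - \<gamma> * lam i)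
             + of_real \<alpha>)) powi (-2)
        * rr_density n (2 * pi * f)))"
proof -
  note rr = assms(11)
  interpret prob_space M using rr by (simp add: random_reshuffling_def)
  obtain H where H: "impulse_response \<gamma> \<alpha> (mean n A) H"
    and xH: "\<And>\<omega>. \<omega> \<in> space M \<Longrightarrow>
      x k \<omega> - minimizer n A b = (\<Sum>\<^sub>\<infinity>j. H (k - j) *v noise n A b (idx j \<omega>))"
    using assms(12) unfolding stationary_sgdm_def by auto
  define D where "D = (\<lambda>\<omega>. x k \<omega> - minimizer n A b)"
  define h where "h = (\<lambda>i m. u i \<bullet> (H m *v u i))"
  define v where "v = (\<lambda>i l. u i \<bullet> noise n A b l)"
  define X where "X = (\<lambda>i \<omega>. u i \<bullet> D \<omega>)"
  have D: "((\<lambda>j. H (k - j) *v noise n A b (idx j \<omega>)) has_sum D \<omega>) UNIV" if "\<omega> \<in> space M" for \<omega>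
    unfolding D_def xH[OF that] by (intro has_sum_infsum filtered_noise_summable[OF rr H that])
  have D_expand: "D \<omega> = (\<Sum>i\<in>UNIV. X i \<omega> *\<^sub>R u i)" for \<omega>
    unfolding X_def by (rule orthonormal_family_expansion[OF assms(4)])
  have unit: "u i \<bullet> u i = 1" for i using assms(4) by simp
  note eig = impulse_response_eigenvector[OF assms(3,7-10) H assms(5)[rule_format] unit]
  have uH: "u i \<bullet> (H m *v y) = h i m * (u i \<bullet> y)" for i m y
    unfolding h_def by (rule eig(1))
  have h_sum: "((\<lambda>m. z powi (- m) * of_real (h i m)) has_sum scalar_transfer \<gamma> \<alpha> (lam i) z) UNIV"
    if "cmod z = 1" for i z
    unfolding h_def by (rule eig(2)[OF that])
  have Xsum: "((\<lambda>j. h i (k - j) * v i (idx j \<omega>)) has_sum X i \<omega>) UNIV" if "\<omega> \<in> space M" for i \<omega>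
    using has_sum_bounded_linear[OF bounded_linear_inner_right[of "u i"] D[OF that]]
    unfolding X_def v_def by (simp only: uH)
  have v0: "mean n (v i) = 0" for i
  proof -
    have "mean n (v i) = u i \<bullet> mean n (noise n A b)"
      by (simp add: v_def mean_def inner_sum_right)
    then show ?thesis using mean_noise[OF assms(3)] by simp
  qed
  note filt = filtered_rr_noise[OF rr assms(1) v0 h_sum Xsum]
  \<comment> \<open>Mixed products are included because the outer product of \<open>D\<close> with
    itself involves all pairs of coordinates.\<close>
  have XX: "integrable M (\<lambda>\<omega>. X i \<omega> * X l \<omega>)" for i l
  proof -
    obtain C where C: "\<And>\<omega>. \<omega> \<in> space M \<Longrightarrow> \<bar>X i \<omega>\<bar> \<le> C" using filt(2)[of i] by auto
    obtain C' where C': "\<And>\<omega>. \<omega> \<in> space M \<Longrightarrow> \<bar>X l \<omega>\<bar> \<le> C'" using filt(2)[of l] by auto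
    show ?thesis
    proof (rule integrable_const_bound[where B = "C * C'"])
      show "AE \<omega> in M. norm (X i \<omega> * X l \<omega>) \<le> C * C'"
        unfolding real_norm_def abs_mult
        by (intro AE_I2 mult_mono C C' order_trans[OF abs_ge_zero C] abs_ge_zero)
    qed (intro borel_measurable_times filt(1))
  qed
  have X1: "integrable M (X i)" for i
  proof -
    obtain C where "\<forall>\<omega>\<in>space M. \<bar>X i \<omega>\<bar> \<le> C" using filt(2)[of i] by auto
    then show ?thesis by (intro integrable_const_bound[where B = C] filt(1)) auto
  qed
  have intD: "integrable M (\<lambda>\<omega>. D \<omega>)"
    by (subst D_expand) (intro Bochner_Integration.integrable_sum integrable_scaleR_left X1)
  have "(LINT \<omega>|M. D \<omega>) = (\<Sum>i\<in>UNIV. LINT \<omega>|M. X i \<omega> *\<^sub>R u i)"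
    by (subst D_expand) (intro Bochner_Integration.integral_sum integrable_scaleR_left X1)
  then have ED: "(LINT \<omega>|M. D \<omega>) = 0"
    using X1 filt(3) by simp
  \<comment> \<open>The mean of the iterate is the minimizer, so centring in the covariance matrix
    produces exactly \<open>D\<close>.\<close>
  have "(LINT \<omega>|M. x k \<omega>) = (LINT \<omega>|M. D \<omega> + minimizer n A b)"
    by (simp add: D_def)
  also have "\<dots> = minimizer n A b" using intD ED by (simp add: prob_space)
  finally have cov: "covariance_matrix M (x k) = (LINT \<omega>|M. outer (D \<omega>) (D \<omega>))"
    by (simp add: covariance_matrix_def D_def)
  \<comment> \<open>Integrability of the matrix-valued outer product is what allows the trace to
    pass under the integral.\<close>
  have "integrable M (\<lambda>\<omega>. \<Sum>i\<in>UNIV. \<Sum>l\<in>UNIV. (X i \<omega> * X l \<omega>) *\<^sub>R outer (u i) (u l))"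
    by (intro Bochner_Integration.integrable_sum integrable_scaleR_left XX)
  moreover have "(\<Sum>i\<in>UNIV. \<Sum>l\<in>UNIV. (X i \<omega> * X l \<omega>) *\<^sub>R outer (u i) (u l)) = outer (D \<omega>) (D \<omega>)" for \<omega>
    unfolding D_expand by (simp add: vec_eq_iff outer_def sum_component sum_product mult_ac)
  ultimately have "integrable M (\<lambda>\<omega>. outer (D \<omega>) (D \<omega>))" by simp
  then have "trace (covariance_matrix M (x k)) = (LINT \<omega>|M. D \<omega> \<bullet> D \<omega>)"
    unfolding cov by (simp add: integral_bounded_linear[OF bounded_linear_trace, symmetric] trace_outer)
  \<comment> \<open>Parseval in the eigenbasis: no mixed products survive, so the correlations
    between coordinates do not enter the trace.\<close>
  also have "D \<omega> \<bullet> D \<omega> = (\<Sum>i\<in>UNIV. X i \<omega> * X i \<omega>)" for \<omega>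
  proof -
    have "D \<omega> \<bullet> D \<omega> = D \<omega> \<bullet> (\<Sum>i\<in>UNIV. X i \<omega> *\<^sub>R u i)"
      by (rule arg_cong[OF D_expand])
    then show ?thesis by (simp add: inner_sum_right X_def inner_commute)
  qed
  then have "(LINT \<omega>|M. D \<omega> \<bullet> D \<omega>) = (\<Sum>i\<in>UNIV. LINT \<omega>|M. X i \<omega> * X i \<omega>)"
    by (simp add: Bochner_Integration.integral_sum XX)
  also have "\<dots> = \<gamma>\<^sup>2 * (\<Sum>i\<in>UNIV. (u i \<bullet> (noise_cov n A b *v u i)) *
      integral {0..1} (\<lambda>f.
        (cmod (exp (- 4 * of_real pi * \<i> * of_real f)
             - exp (- 2 * of_real pi * \<i> * of_real f) * of_real (1 + \<alpha> - \<gamma> * lam i)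
             + of_real \<alpha>)) powi (-2)
        * rr_density n (2 * pi * f)))"
    unfolding sum_distrib_left
  proof (intro sum.cong refl)
    fix i
    have rho: "rr_density n = rr_poly n"
      using assms(1) by (intro ext rr_density_eq_rr_poly) simp
    have EX2: "(LINT \<omega>|M. X i \<omega> * X i \<omega>) = mean n (\<lambda>l. (v i l)\<^sup>2) *
        integral {0..1} (\<lambda>f. (cmod (scalar_transfer \<gamma> \<alpha> (lam i) (cis (2 * pi * f))))\<^sup>2 * rr_poly n (2 * pi * f))"
      by (rule filt(4))
    show "(LINT \<omega>|M. X i \<omega> * X i \<omega>) = \<gamma>\<^sup>2 * ((u i \<bullet> (noise_cov n A b *v u i)) *
      integral {0..1} (\<lambda>f.
        (cmod (exp (- 4 * of_real pi * \<i> * of_real f)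
             - exp (- 2 * of_real pi * \<i> * of_real f) * of_real (1 + \<alpha> - \<gamma> * lam i)
             + of_real \<alpha>)) powi (-2)
        * rr_density n (2 * pi * f)))"
      unfolding EX2 norm_scalar_transfer_cis[OF assms(7)] quadratic_form_noise_cov v_def rho
      unfolding mult.assoc integral_mult_right
      by (simp only: mult.left_commute)
  qed
  finally show ?thesis .
qed

end
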